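(* Let $H$ be a Hopf algebra and let $\pi:L\to H$ be a relative Rota-Baxter operator on $H$ with respect to $(L,\rightharpoonup)$. Let $L_{[\pi]}=(L,\circ_\pi,1_L,\Delta_L,\varepsilon_L,T_\pi)$ be the Hopf algebra with $$a\circ_\pi b=a_1(\pi(a_2)\rightharpoonup b),\qquad T_\pi(a)=S_H(\pi(a_1))\rightharpoonup S_L(a_2),\qquad a,b\in L,$$ and let $x\leftharpoonup a=S_H(\pi(x_1\rightharpoonup a_1))x_2\pi(a_2)$ for $x\in H$, $a\in L$, a right $L_{[\pi]}$-module coalgebra action on $H$. Then the map $\pi:L\to H$ is a morphism of right-left $(L_{[\pi]},L_{[\pi]},H)$-Doi-Hopf modules, where $H$ carries the right $L_{[\pi]}$-action $\leftharpoonup$ and the left $H$-coaction $\Delta_H$, and $L$ carries the right $L_{[\pi]}$-action $$a\leftharpoonup_\pi b=T_\pi(\pi(a_1)\rightharpoonup b_1)\circ_\pi a_2\circ_\pi b_2$$ and the left $H$-coaction $(\pi\otimes\mathrm{id}_L)\Delta_L$.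
   Context: Everything is over a fixed arbitrary field $\mathbf{k}$; Sweedler notation $\Delta(x)=x_1\otimes x_2$, $\Delta^{(2)}(x)=x_1\otimes x_2\otimes x_3$; $S_H$ is the antipode of $H$. A (left-left) Yetter-Drinfeld module over $H$ is a left $H$-module $(M,\cdot)$ that is also a left $H$-comodule with coaction $\rho(m)=m_{-1}\otimes m_0\in H\otimes M$, such that $\rho(x\cdot m)=x_1m_{-1}S_H(x_3)\otimes(x_2\cdot m_0)$. Morphisms are $H$-linear and $H$-colinear maps; ${}^H_H\mathcal{YD}$ is the resulting category. Tensor products carry $x\cdot(m\otimes n)=(x_1\cdot m)\otimes(x_2\cdot n)$ and $\rho(m\otimes n)=m_{-1}n_{-1}\otimes(m_0\otimes n_0)$; the (pre-)braiding is $c_{M,N}(m\otimes n)=(m_{-1}\cdot n)\otimes m_0$. A (braided) Hopf algebra $L$ in ${}^H_H\mathcal{YD}$ is an object that is a unital algebra and a counital coalgebra whose structure maps (product, unit, coproduct, counit, antipode) are morphisms in ${}^H_H\mathcal{YD}$, with $\varepsilon_L$ an algebra map, $\Delta_L(1)=1\otimes 1$, $\Delta_L(ab)=a_1((a_2)_{-1}\cdot b_1)\otimes(a_2)_0b_2$, and with antipode $S_L$ the convolution inverse of $\mathrm{id}_L$. Relative Rota-Baxter operator: let $H$ be a Hopf algebra, $L$ a Hopf algebra in ${}^H_H\mathcal{YD}$ with respect to an $H$-action $\rightharpoonup$ and the $H$-coaction $\mathrm{Coad}_\pi:L\to H\otimes L$, $a\mapsto\pi(a_1)S_H(\pi(a_3))\otimes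 a_2$, where $\pi:L\to H$ is a coalgebra homomorphism such that $\pi(a)\pi(b)=\pi(a_1(\pi(a_2)\rightharpoonup b))$ for all $a,b\in L$. Then $\pi$ is called a (Yetter-Drinfeld) relative Rota-Baxter operator on $H$ with respect to $(L,\rightharpoonup)$. Doi-Hopf modules: given a Hopf algebra $B$, a left $B$-comodule algebra $A$ (coaction $a\mapsto a_{-1}\otimes a_0\in B\otimes A$) and a right $B$-module coalgebra $C$ (action written $\leftharpoonup$), a (right-left) $(B,A,C)$-Doi-Hopf module $M$ is a right $A$-module $(M,\cdot)$ and a left $C$-comodule $(M,\rho)$, $\rho(m)=m_{-1}\otimes m_0\in C\otimes M$, such that $\rho(m\cdot a)=(m_{-1}\leftharpoonup a_{-1})\otimes(m_0\cdot a_0)$ for all $a\in A$, $m\in M$. A morphism of $(B,A,C)$-Doi-Hopf modules is a map that is right $A$-linear and left $C$-colinear. Here $B=A=L_{[\pi]}$, a left comodule algebra over itself via $\Delta_L$, and $C=H$ with the action $\leftharpoonup$. *)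

theory Defs
  imports "HOL.Vector_Spaces" "HOL-Library.Poly_Mapping"
begin

text \<open>
  Vector spaces over the field \<^typ>\<open>'k::field\<close> are types of class \<^class>\<open>ab_group_add\<close> with a scalar
  multiplication satisfying \<^locale>\<open>vector_space\<close>; the field itself has scalar multiplication
  \<open>(*)\<close>.
\<close>

definition bilin ::
  "('k::field \<Rightarrow> 'a::ab_group_add \<Rightarrow> 'a) \<Rightarrow> ('k \<Rightarrow> 'b::ab_group_add \<Rightarrow> 'b) \<Rightarrow>
   ('k \<Rightarrow> 'c::ab_group_add \<Rightarrow> 'c) \<Rightarrow> ('a \<Rightarrow> 'b \<Rightarrow> 'c) \<Rightarrow> bool" where
  "bilin sa sb sc f \<longleftrightarrow>
     (\<forall>a. Vector_Spaces.linear sb sc (f a)) \<and> (\<forall>b. Vector_Spaces.linear sa sc (\<lambda>a. f a b))"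


section \<open>Tensor products\<close>

text \<open>
  \<open>'x \<Rightarrow>\<^sub>0 'k\<close> is the free vector space on \<open>'x\<close>. The tensor product of \<open>V\<close> and \<open>W\<close> is the
  quotient of the free vector space on \<open>V \<times> W\<close> by the span of the bilinearity relations; an
  element of it is a coset, i.e. a set of formal sums. Threefold tensor products are built in the
  same way from the trilinearity relations.
\<close>

definition fscale :: "'k::field \<Rightarrow> ('x \<Rightarrow>\<^sub>0 'k) \<Rightarrow> ('x \<Rightarrow>\<^sub>0 'k)" where
  "fscale c f = Poly_Mapping.map ((*) c) f"

abbreviation pure :: "'x \<Rightarrow> ('x \<Rightarrow>\<^sub>0 'k::field)" where
  "pure x \<equiv> Poly_Mapping.single x 1"

lemma lookup_fscale [simp]: "Poly_Mapping.lookup (fscale c f) x = c * Poly_Mapping.lookup f x"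
  by (simp add: fscale_def Poly_Mapping.map.rep_eq when_def)

lemma vector_space_fscale: "vector_space fscale"
  by unfold_locales (auto intro!: poly_mapping_eqI simp: lookup_add algebra_simps)

definition relations2 ::
  "('k::field \<Rightarrow> 'a::ab_group_add \<Rightarrow> 'a) \<Rightarrow> ('k \<Rightarrow> 'b::ab_group_add \<Rightarrow> 'b) \<Rightarrow>
   (('a \<times> 'b) \<Rightarrow>\<^sub>0 'k) set" where
  "relations2 sa sb =
     {pure (a + a', b) - pure (a, b) - pure (a', b) | a a' b. True} \<union>
     {pure (a, b + b') - pure (a, b) - pure (a, b') | a b b'. True} \<union>
     {pure (sa c a, b) - fscale c (pure (a, b)) | c a b. True} \<union>
     {pure (a, sb c b) - fscale c (pure (a, b)) | c a b. True}"

definition relations3 ::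
  "('k::field \<Rightarrow> 'a::ab_group_add \<Rightarrow> 'a) \<Rightarrow> ('k \<Rightarrow> 'b::ab_group_add \<Rightarrow> 'b) \<Rightarrow>
   ('k \<Rightarrow> 'c::ab_group_add \<Rightarrow> 'c) \<Rightarrow> (('a \<times> 'b \<times> 'c) \<Rightarrow>\<^sub>0 'k) set" where
  "relations3 sa sb sc =
     {pure (a + a', b, c) - pure (a, b, c) - pure (a', b, c) | a a' b c. True} \<union>
     {pure (a, b + b', c) - pure (a, b, c) - pure (a, b', c) | a b b' c. True} \<union>
     {pure (a, b, c + c') - pure (a, b, c) - pure (a, b, c') | a b c c'. True} \<union>
     {pure (sa r a, b, c) - fscale r (pure (a, b, c)) | r a b c. True} \<union>
     {pure (a, sb r b, c) - fscale r (pure (a, b, c)) | r a b c. True} \<union>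
     {pure (a, b, sc r c) - fscale r (pure (a, b, c)) | r a b c. True}"

type_synonym ('k, 'x) tensor = "('x \<Rightarrow>\<^sub>0 'k) set"

definition tens2 ::
  "('k::field \<Rightarrow> 'a::ab_group_add \<Rightarrow> 'a) \<Rightarrow> ('k \<Rightarrow> 'b::ab_group_add \<Rightarrow> 'b) \<Rightarrow>
   (('a \<times> 'b) \<Rightarrow>\<^sub>0 'k) \<Rightarrow> ('k, 'a \<times> 'b) tensor" where
  "tens2 sa sb f = {g. g - f \<in> module.span fscale (relations2 sa sb)}"

definition tens3 ::
  "('k::field \<Rightarrow> 'a::ab_group_add \<Rightarrow> 'a) \<Rightarrow> ('k \<Rightarrow> 'b::ab_group_add \<Rightarrow> 'b) \<Rightarrow>
   ('k \<Rightarrow> 'c::ab_group_add \<Rightarrow> 'c) \<Rightarrow>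
   (('a \<times> 'b \<times> 'c) \<Rightarrow>\<^sub>0 'k) \<Rightarrow> ('k, 'a \<times> 'b \<times> 'c) tensor" where
  "tens3 sa sb sc f = {g. g - f \<in> module.span fscale (relations3 sa sb sc)}"

definition rep :: "('k::field, 'x) tensor \<Rightarrow> ('x \<Rightarrow>\<^sub>0 'k)" where
  "rep t = (SOME f. f \<in> t)"

definition fextend ::
  "('k::field \<Rightarrow> 'c::ab_group_add \<Rightarrow> 'c) \<Rightarrow> ('x \<Rightarrow> 'c) \<Rightarrow> ('x \<Rightarrow>\<^sub>0 'k) \<Rightarrow> 'c" where
  "fextend s F f = (\<Sum>x\<in>Poly_Mapping.keys f. s (Poly_Mapping.lookup f x) (F x))"

text \<open>
  Sweedler notation: for a tensor \<open>t\<close> written as a sum of pure tensors \<open>t\<^sub>1 \<otimes> t\<^sub>2\<close>,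
  \<open>sweedler s t (\<lambda>(t\<^sub>1, t\<^sub>2). F t\<^sub>1 t\<^sub>2)\<close> is the sum of the \<open>F t\<^sub>1 t\<^sub>2\<close> in the vector space with scalar
  multiplication \<open>s\<close>. It does not depend on the representative when \<open>F\<close> is bilinear (see
  \<open>sweedler_tens2\<close> below). \<open>sw\<close> is the version with values in formal sums, whose class is then
  taken with \<^const>\<open>tens2\<close> or \<^const>\<open>tens3\<close>; there independence holds for that class when \<open>F\<close> is
  bilinear modulo the relations.
\<close>

definition sweedler ::
  "('k::field \<Rightarrow> 'c::ab_group_add \<Rightarrow> 'c) \<Rightarrow> ('k, 'x) tensor \<Rightarrow> ('x \<Rightarrow> 'c) \<Rightarrow> 'c" where
  "sweedler s t F = fextend s F (rep t)"

abbreviation sw :: "('k::field, 'x) tensor \<Rightarrow> ('x \<Rightarrow> ('y \<Rightarrow>\<^sub>0 'k)) \<Rightarrow> ('y \<Rightarrow>\<^sub>0 'k)" where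
  "sw \<equiv> sweedler fscale"

definition tensor_linear ::
  "('k::field \<Rightarrow> 'm::ab_group_add \<Rightarrow> 'm) \<Rightarrow> ('k \<Rightarrow> 'a::ab_group_add \<Rightarrow> 'a) \<Rightarrow>
   ('k \<Rightarrow> 'b::ab_group_add \<Rightarrow> 'b) \<Rightarrow> ('m \<Rightarrow> ('k, 'a \<times> 'b) tensor) \<Rightarrow> bool" where
  "tensor_linear sm sa sb f \<longleftrightarrow>
     vector_space sm \<and> vector_space sa \<and> vector_space sb \<and>
     (\<forall>m. f m \<in> range (tens2 sa sb)) \<and>
     (\<forall>m n. f (m + n) = tens2 sa sb (rep (f m) + rep (f n))) \<and>
     (\<forall>c m. f (sm c m) = tens2 sa sb (fscale c (rep (f m))))"

lemma linear_fextend: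
  fixes s :: "'k::field \<Rightarrow> 'c::ab_group_add \<Rightarrow> 'c" and F :: "'x \<Rightarrow> 'c"
  assumes "vector_space s"
  shows "Vector_Spaces.linear fscale s (fextend s F)"
proof -
  interpret S: vector_space s by fact
  interpret FS: vector_space fscale by (rule vector_space_fscale)
  have ext: "fextend s F f = (\<Sum>x\<in>A. s (Poly_Mapping.lookup f x) (F x))"
    if "finite A" "Poly_Mapping.keys f \<subseteq> A" for f :: "'x \<Rightarrow>\<^sub>0 'k" and A
    unfolding fextend_def using that
    by (intro sum.mono_neutral_left) (auto simp: in_keys_iff)
  show ?thesis
  proof (unfold_locales)
    fix f g :: "'x \<Rightarrow>\<^sub>0 'k"
    let ?A = "Poly_Mapping.keys f \<union> Poly_Mapping.keys g"
    show "fextend s F (f + g) = fextend s F f + fextend s F g"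
      using keys_add[of f g] ext[of ?A "f + g"] ext[of ?A f] ext[of ?A g]
      by (simp add: lookup_add S.scale_left_distrib sum.distrib)
  next
    fix c and f :: "'x \<Rightarrow>\<^sub>0 'k"
    have "Poly_Mapping.keys (fscale c f) \<subseteq> Poly_Mapping.keys f"
      by (auto simp: in_keys_iff)
    then show "fextend s F (fscale c f) = s c (fextend s F f)"
      using ext[of "Poly_Mapping.keys f" "fscale c f"] ext[of "Poly_Mapping.keys f" f]
      by (simp add: S.scale_sum_right)
  qed
qed

lemma fextend_pure: "vector_space s \<Longrightarrow> fextend s F (pure x) = F x"
  by (simp add: fextend_def vector_space.vector_space_assms(4))

lemma sweedler_tens2:
  assumes F: "bilin sa sb s F"
  shows "sweedler s (tens2 sa sb f) (\<lambda>(a, b). F a b) = fextend s (\<lambda>(a, b). F a b) f"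
proof -
  have lin: "Vector_Spaces.linear sb s (F a)" "Vector_Spaces.linear sa s (\<lambda>a. F a b)" for a b
    using F by (auto simp: bilin_def)
  have vs: "vector_space s"
    using lin(1)[of undefined] by (simp add: Vector_Spaces.linear_iff)
  interpret FS: vector_space fscale by (rule vector_space_fscale)
  let ?E = "fextend s (\<lambda>(a, b). F a b)"
  interpret E: Vector_Spaces.linear fscale s ?E
    by (rule linear_fextend[OF vs])
  have rel: "?E r = 0" if "r \<in> relations2 sa sb" for r
    using that lin
    by (auto simp: relations2_def E.diff E.scale fextend_pure[OF vs] Vector_Spaces.linear_iff)
  have null: "?E r = 0" if "r \<in> module.span fscale (relations2 sa sb)" for r
    using that by (rule FS.span_induct_alt) (auto simp: E.add E.scale rel)
  have "f \<in> tens2 sa sb f"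
    by (simp add: tens2_def FS.span_zero)
  then have "rep (tens2 sa sb f) \<in> tens2 sa sb f"
    unfolding rep_def by (rule someI)
  then have "?E (rep (tens2 sa sb f) - f) = 0"
    by (intro null) (simp add: tens2_def)
  then show ?thesis
    by (simp add: sweedler_def E.diff)
qed


section \<open>Algebras, coalgebras, Hopf algebras\<close>

text \<open>
  One record carries all structure maps; a predicate refers only to the fields that belong to the
  structure it describes, the other fields being arbitrary.
\<close>

record (overloaded) ('k::zero, 'a) hopf_data =
  scl :: "'k \<Rightarrow> 'a \<Rightarrow> 'a"
  mul :: "'a \<Rightarrow> 'a \<Rightarrow> 'a"
  one :: 'a
  cop :: "'a \<Rightarrow> ('k, 'a \<times> 'a) tensor"
  cou :: "'a \<Rightarrow> 'k"
  ant :: "'a \<Rightarrow> 'a"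

definition is_algebra :: "('k::field, 'a::ab_group_add) hopf_data \<Rightarrow> bool" where
  "is_algebra A \<longleftrightarrow>
     vector_space (scl A) \<and> bilin (scl A) (scl A) (scl A) (mul A) \<and>
     (\<forall>a b c. mul A (mul A a b) c = mul A a (mul A b c)) \<and>
     (\<forall>a. mul A (one A) a = a \<and> mul A a (one A) = a)"

definition is_coalgebra :: "('k::field, 'a::ab_group_add) hopf_data \<Rightarrow> bool" where
  "is_coalgebra C \<longleftrightarrow>
     vector_space (scl C) \<and>
     tensor_linear (scl C) (scl C) (scl C) (cop C) \<and>
     Vector_Spaces.linear (scl C) (*) (cou C) \<and>
     (\<forall>x. tens3 (scl C) (scl C) (scl C)
            (sw (cop C x) (\<lambda>(y, x3). sw (cop C y) (\<lambda>(x1, x2). pure (x1, x2, x3)))) =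
          tens3 (scl C) (scl C) (scl C)
            (sw (cop C x) (\<lambda>(x1, y). sw (cop C y) (\<lambda>(x2, x3). pure (x1, x2, x3))))) \<and>
     (\<forall>x. sweedler (scl C) (cop C x) (\<lambda>(x1, x2). scl C (cou C x1) x2) = x \<and>
          sweedler (scl C) (cop C x) (\<lambda>(x1, x2). scl C (cou C x2) x1) = x)"

definition is_antipode :: "('k::field, 'a::ab_group_add) hopf_data \<Rightarrow> bool" where
  "is_antipode H \<longleftrightarrow>
     Vector_Spaces.linear (scl H) (scl H) (ant H) \<and>
     (\<forall>x. sweedler (scl H) (cop H x) (\<lambda>(x1, x2). mul H (ant H x1) x2) = scl H (cou H x) (one H) \<and>
          sweedler (scl H) (cop H x) (\<lambda>(x1, x2). mul H x1 (ant H x2)) = scl H (cou H x) (one H))"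

definition is_hopf :: "('k::field, 'a::ab_group_add) hopf_data \<Rightarrow> bool" where
  "is_hopf H \<longleftrightarrow>
     is_algebra H \<and> is_coalgebra H \<and>
     (\<forall>x y. cop H (mul H x y) = tens2 (scl H) (scl H)
        (sw (cop H x) (\<lambda>(x1, x2). sw (cop H y) (\<lambda>(y1, y2). pure (mul H x1 y1, mul H x2 y2))))) \<and>
     cop H (one H) = tens2 (scl H) (scl H) (pure (one H, one H)) \<and>
     (\<forall>x y. cou H (mul H x y) = cou H x * cou H y) \<and>
     cou H (one H) = 1 \<and>
     is_antipode H"

definition coalgebra_hom ::
  "('k::field, 'c::ab_group_add) hopf_data \<Rightarrow> ('k, 'd::ab_group_add) hopf_data \<Rightarrow>
   ('c \<Rightarrow> 'd) \<Rightarrow> bool" where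
  "coalgebra_hom C D f \<longleftrightarrow>
     Vector_Spaces.linear (scl C) (scl D) f \<and>
     (\<forall>x. cop D (f x) = tens2 (scl D) (scl D) (sw (cop C x) (\<lambda>(x1, x2). pure (f x1, f x2)))) \<and>
     (\<forall>x. cou D (f x) = cou C x)"

definition left_module ::
  "('k::field, 'a::ab_group_add) hopf_data \<Rightarrow> ('k \<Rightarrow> 'm::ab_group_add \<Rightarrow> 'm) \<Rightarrow>
   ('a \<Rightarrow> 'm \<Rightarrow> 'm) \<Rightarrow> bool" where
  "left_module A sm act \<longleftrightarrow>
     vector_space sm \<and> bilin (scl A) sm sm act \<and>
     (\<forall>m. act (one A) m = m) \<and>
     (\<forall>a b m. act (mul A a b) m = act a (act b m))"

definition right_module ::
  "('k::field, 'a::ab_group_add) hopf_data \<Rightarrow> ('k \<Rightarrow> 'm::ab_group_add \<Rightarrow> 'm) \<Rightarrow>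
   ('m \<Rightarrow> 'a \<Rightarrow> 'm) \<Rightarrow> bool" where
  "right_module A sm act \<longleftrightarrow>
     vector_space sm \<and> bilin sm (scl A) sm act \<and>
     (\<forall>m. act m (one A) = m) \<and>
     (\<forall>m a b. act m (mul A a b) = act (act m a) b)"

definition left_comodule ::
  "('k::field, 'c::ab_group_add) hopf_data \<Rightarrow> ('k \<Rightarrow> 'm::ab_group_add \<Rightarrow> 'm) \<Rightarrow>
   ('m \<Rightarrow> ('k, 'c \<times> 'm) tensor) \<Rightarrow> bool" where
  "left_comodule C sm \<rho> \<longleftrightarrow>
     vector_space sm \<and> tensor_linear sm (scl C) sm \<rho> \<and>
     (\<forall>m. tens3 (scl C) (scl C) sm
            (sw (\<rho> m) (\<lambda>(c, m0). sw (cop C c) (\<lambda>(c1, c2). pure (c1, c2, m0)))) =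
          tens3 (scl C) (scl C) sm
            (sw (\<rho> m) (\<lambda>(c, m0). sw (\<rho> m0) (\<lambda>(c', m00). pure (c, c', m00))))) \<and>
     (\<forall>m. sweedler sm (\<rho> m) (\<lambda>(c, m0). sm (cou C c) m0) = m)"


section \<open>Yetter-Drinfeld modules and braided Hopf algebras\<close>

record (overloaded) ('k::zero, 'h, 'm) yd_data =
  ysc :: "'k \<Rightarrow> 'm \<Rightarrow> 'm"
  yact :: "'h \<Rightarrow> 'm \<Rightarrow> 'm"
  yco :: "'m \<Rightarrow> ('k, 'h \<times> 'm) tensor"

definition yd_module ::
  "('k::field, 'h::ab_group_add) hopf_data \<Rightarrow> ('k, 'h, 'm::ab_group_add) yd_data \<Rightarrow> bool" where
  "yd_module H M \<longleftrightarrow>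
     left_module H (ysc M) (yact M) \<and> left_comodule H (ysc M) (yco M) \<and>
     (\<forall>x m. yco M (yact M x m) = tens2 (scl H) (ysc M)
        (sw (cop H x) (\<lambda>(x1, y). sw (cop H y) (\<lambda>(x2, x3). sw (yco M m) (\<lambda>(h, m0).
           pure (mul H (mul H x1 h) (ant H x3), yact M x2 m0))))))"

definition yd_morphism ::
  "('k::field, 'h::ab_group_add) hopf_data \<Rightarrow> ('k, 'h, 'm::ab_group_add) yd_data \<Rightarrow>
   ('k, 'h, 'n::ab_group_add) yd_data \<Rightarrow> ('m \<Rightarrow> 'n) \<Rightarrow> bool" where
  "yd_morphism H M N f \<longleftrightarrow>
     Vector_Spaces.linear (ysc M) (ysc N) f \<and>
     (\<forall>x m. f (yact M x m) = yact N x (f m)) \<and>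
     (\<forall>m. yco N (f m) = tens2 (scl H) (ysc N) (sw (yco M m) (\<lambda>(h, m0). pure (h, f m0))))"

definition yd_unit :: "('k::field, 'h::ab_group_add) hopf_data \<Rightarrow> ('k, 'h, 'k) yd_data" where
  "yd_unit H = \<lparr> ysc = (*), yact = (\<lambda>x c. cou H x * c),
                 yco = (\<lambda>c. tens2 (scl H) (*) (pure (one H, c))) \<rparr>"

text \<open>
  The next two predicates are \<^const>\<open>yd_morphism\<close> for maps out of, respectively into, a tensor
  product \<open>M \<otimes> N\<close> with the diagonal action and the codiagonal coaction. A linear map out of
  \<open>M \<otimes> N\<close> is given as a bilinear map, and it suffices to state the two equations on pure tensors.
\<close>

definition yd_morphism_from_tensor ::
  "('k::field, 'h::ab_group_add) hopf_data \<Rightarrow> ('k, 'h, 'm::ab_group_add) yd_data \<Rightarrow>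
   ('k, 'h, 'n::ab_group_add) yd_data \<Rightarrow> ('k, 'h, 'p::ab_group_add) yd_data \<Rightarrow>
   ('m \<Rightarrow> 'n \<Rightarrow> 'p) \<Rightarrow> bool" where
  "yd_morphism_from_tensor H M N P f \<longleftrightarrow>
     bilin (ysc M) (ysc N) (ysc P) f \<and>
     (\<forall>x m n. sweedler (ysc P) (cop H x) (\<lambda>(x1, x2). f (yact M x1 m) (yact N x2 n)) =
        yact P x (f m n)) \<and>
     (\<forall>m n. yco P (f m n) = tens2 (scl H) (ysc P)
        (sw (yco M m) (\<lambda>(h, m0). sw (yco N n) (\<lambda>(h', n0). pure (mul H h h', f m0 n0)))))"

definition yd_morphism_to_tensor ::
  "('k::field, 'h::ab_group_add) hopf_data \<Rightarrow> ('k, 'h, 'p::ab_group_add) yd_data \<Rightarrow>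
   ('k, 'h, 'm::ab_group_add) yd_data \<Rightarrow> ('k, 'h, 'n::ab_group_add) yd_data \<Rightarrow>
   ('p \<Rightarrow> ('k, 'm \<times> 'n) tensor) \<Rightarrow> bool" where
  "yd_morphism_to_tensor H P M N f \<longleftrightarrow>
     tensor_linear (ysc P) (ysc M) (ysc N) f \<and>
     (\<forall>x p. f (yact P x p) = tens2 (ysc M) (ysc N)
        (sw (cop H x) (\<lambda>(x1, x2). sw (f p) (\<lambda>(m, n). pure (yact M x1 m, yact N x2 n))))) \<and>
     (\<forall>p. tens3 (scl H) (ysc M) (ysc N)
            (sw (f p) (\<lambda>(m, n). sw (yco M m) (\<lambda>(h, m0). sw (yco N n) (\<lambda>(h', n0).
               pure (mul H h h', m0, n0))))) =
          tens3 (scl H) (ysc M) (ysc N)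
            (sw (yco P p) (\<lambda>(h, p0). sw (f p0) (\<lambda>(m, n). pure (h, m, n)))))"

definition yd_hopf ::
  "('k::field, 'h::ab_group_add) hopf_data \<Rightarrow> ('k, 'l::ab_group_add) hopf_data \<Rightarrow>
   ('h \<Rightarrow> 'l \<Rightarrow> 'l) \<Rightarrow> ('l \<Rightarrow> ('k, 'h \<times> 'l) tensor) \<Rightarrow> bool" where
  "yd_hopf H L act \<rho> \<longleftrightarrow> (let Y = \<lparr> ysc = scl L, yact = act, yco = \<rho> \<rparr> in
     yd_module H Y \<and> is_algebra L \<and> is_coalgebra L \<and>
     yd_morphism_from_tensor H Y Y Y (mul L) \<and>
     yd_morphism H (yd_unit H) Y (\<lambda>c. scl L c (one L)) \<and>
     yd_morphism_to_tensor H Y Y Y (cop L) \<and>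
     yd_morphism H Y (yd_unit H) (cou L) \<and>
     yd_morphism H Y Y (ant L) \<and>
     (\<forall>a b. cou L (mul L a b) = cou L a * cou L b) \<and> cou L (one L) = 1 \<and>
     cop L (one L) = tens2 (scl L) (scl L) (pure (one L, one L)) \<and>
     (\<forall>a b. cop L (mul L a b) = tens2 (scl L) (scl L)
        (sw (cop L a) (\<lambda>(a1, a2). sw (\<rho> a2) (\<lambda>(h, a20). sw (cop L b) (\<lambda>(b1, b2).
           pure (mul L a1 (act h b1), mul L a20 b2)))))) \<and>
     is_antipode L)"


section \<open>Relative Rota-Baxter operators\<close>

definition coad ::
  "('k::field, 'h::ab_group_add) hopf_data \<Rightarrow> ('k, 'l::ab_group_add) hopf_data \<Rightarrow> ('l \<Rightarrow> 'h) \<Rightarrow>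
   'l \<Rightarrow> ('k, 'h \<times> 'l) tensor" where
  "coad H L \<pi> a = tens2 (scl H) (scl L)
     (sw (cop L a) (\<lambda>(a1, b). sw (cop L b) (\<lambda>(a2, a3). pure (mul H (\<pi> a1) (ant H (\<pi> a3)), a2))))"

definition circ ::
  "('k::field, 'l::ab_group_add) hopf_data \<Rightarrow> ('h::ab_group_add \<Rightarrow> 'l \<Rightarrow> 'l) \<Rightarrow> ('l \<Rightarrow> 'h) \<Rightarrow>
   'l \<Rightarrow> 'l \<Rightarrow> 'l" where
  "circ L act \<pi> a b = sweedler (scl L) (cop L a) (\<lambda>(a1, a2). mul L a1 (act (\<pi> a2) b))"

definition rel_rota_baxter ::
  "('k::field, 'h::ab_group_add) hopf_data \<Rightarrow> ('k, 'l::ab_group_add) hopf_data \<Rightarrow>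
   ('h \<Rightarrow> 'l \<Rightarrow> 'l) \<Rightarrow> ('l \<Rightarrow> 'h) \<Rightarrow> bool" where
  "rel_rota_baxter H L act \<pi> \<longleftrightarrow>
     is_hopf H \<and> coalgebra_hom L H \<pi> \<and> yd_hopf H L act (coad H L \<pi>) \<and>
     (\<forall>a b. mul H (\<pi> a) (\<pi> b) =
        \<pi> (sweedler (scl L) (cop L a) (\<lambda>(a1, a2). mul L a1 (act (\<pi> a2) b))))"

definition T_pi ::
  "('k::field, 'h::ab_group_add) hopf_data \<Rightarrow> ('k, 'l::ab_group_add) hopf_data \<Rightarrow>
   ('h \<Rightarrow> 'l \<Rightarrow> 'l) \<Rightarrow> ('l \<Rightarrow> 'h) \<Rightarrow> 'l \<Rightarrow> 'l" where
  "T_pi H L act \<pi> a =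
     sweedler (scl L) (cop L a) (\<lambda>(a1, a2). act (ant H (\<pi> a1)) (ant L a2))"

definition L_pi ::
  "('k::field, 'h::ab_group_add) hopf_data \<Rightarrow> ('k, 'l::ab_group_add) hopf_data \<Rightarrow>
   ('h \<Rightarrow> 'l \<Rightarrow> 'l) \<Rightarrow> ('l \<Rightarrow> 'h) \<Rightarrow> ('k, 'l) hopf_data" where
  "L_pi H L act \<pi> =
     \<lparr> scl = scl L, mul = circ L act \<pi>, one = one L, cop = cop L, cou = cou L,
       ant = T_pi H L act \<pi> \<rparr>"

text \<open>The right action of \<^const>\<open>L_pi\<close> on \<open>H\<close>, and then the one on \<open>L\<close>.\<close>

definition ract_H ::
  "('k::field, 'h::ab_group_add) hopf_data \<Rightarrow> ('k, 'l::ab_group_add) hopf_data \<Rightarrow>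
   ('h \<Rightarrow> 'l \<Rightarrow> 'l) \<Rightarrow> ('l \<Rightarrow> 'h) \<Rightarrow> 'h \<Rightarrow> 'l \<Rightarrow> 'h" where
  "ract_H H L act \<pi> x a =
     sweedler (scl H) (cop H x) (\<lambda>(x1, x2). sweedler (scl H) (cop L a) (\<lambda>(a1, a2).
       mul H (mul H (ant H (\<pi> (act x1 a1))) x2) (\<pi> a2)))"

definition ract_L ::
  "('k::field, 'h::ab_group_add) hopf_data \<Rightarrow> ('k, 'l::ab_group_add) hopf_data \<Rightarrow>
   ('h \<Rightarrow> 'l \<Rightarrow> 'l) \<Rightarrow> ('l \<Rightarrow> 'h) \<Rightarrow> 'l \<Rightarrow> 'l \<Rightarrow> 'l" where
  "ract_L H L act \<pi> a b =
     sweedler (scl L) (cop L a) (\<lambda>(a1, a2). sweedler (scl L) (cop L b) (\<lambda>(b1, b2).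
       circ L act \<pi> (circ L act \<pi> (T_pi H L act \<pi> (act (\<pi> a1) b1)) a2) b2))"

definition coact_L ::
  "('k::field, 'h::ab_group_add) hopf_data \<Rightarrow> ('k, 'l::ab_group_add) hopf_data \<Rightarrow> ('l \<Rightarrow> 'h) \<Rightarrow>
   'l \<Rightarrow> ('k, 'h \<times> 'l) tensor" where
  "coact_L H L \<pi> a = tens2 (scl H) (scl L) (sw (cop L a) (\<lambda>(a1, a2). pure (\<pi> a1, a2)))"


section \<open>Doi-Hopf modules\<close>

definition left_comodule_algebra ::
  "('k::field, 'b::ab_group_add) hopf_data \<Rightarrow> ('k, 'a::ab_group_add) hopf_data \<Rightarrow>
   ('a \<Rightarrow> ('k, 'b \<times> 'a) tensor) \<Rightarrow> bool" where
  "left_comodule_algebra B A coA \<longleftrightarrow>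
     is_algebra A \<and> left_comodule B (scl A) coA \<and>
     (\<forall>x y. coA (mul A x y) = tens2 (scl B) (scl A)
        (sw (coA x) (\<lambda>(b, x0). sw (coA y) (\<lambda>(b', y0). pure (mul B b b', mul A x0 y0))))) \<and>
     coA (one A) = tens2 (scl B) (scl A) (pure (one B, one A))"

definition right_module_coalgebra ::
  "('k::field, 'b::ab_group_add) hopf_data \<Rightarrow> ('k, 'c::ab_group_add) hopf_data \<Rightarrow>
   ('c \<Rightarrow> 'b \<Rightarrow> 'c) \<Rightarrow> bool" where
  "right_module_coalgebra B C ra \<longleftrightarrow>
     is_coalgebra C \<and> right_module B (scl C) ra \<and>
     (\<forall>c b. cop C (ra c b) = tens2 (scl C) (scl C)
        (sw (cop C c) (\<lambda>(c1, c2). sw (cop B b) (\<lambda>(b1, b2). pure (ra c1 b1, ra c2 b2))))) \<and>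
     (\<forall>c b. cou C (ra c b) = cou C c * cou B b)"

text \<open>
  A Doi-Hopf datum is a Hopf algebra \<open>B\<close>, a left \<open>B\<close>-comodule algebra \<open>A\<close> with coaction \<open>coA\<close>, and
  a right \<open>B\<close>-module coalgebra \<open>C\<close> with action \<open>ra\<close>.
\<close>

definition doi_hopf_datum ::
  "('k::field, 'b::ab_group_add) hopf_data \<Rightarrow>
   ('k, 'a::ab_group_add) hopf_data \<Rightarrow> ('a \<Rightarrow> ('k, 'b \<times> 'a) tensor) \<Rightarrow>
   ('k, 'c::ab_group_add) hopf_data \<Rightarrow> ('c \<Rightarrow> 'b \<Rightarrow> 'c) \<Rightarrow> bool" where
  "doi_hopf_datum B A coA C ra \<longleftrightarrow>
     is_hopf B \<and> left_comodule_algebra B A coA \<and> right_module_coalgebra B C ra"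

definition doi_hopf_module ::
  "('k::field, 'b::ab_group_add) hopf_data \<Rightarrow>
   ('k, 'a::ab_group_add) hopf_data \<Rightarrow> ('a \<Rightarrow> ('k, 'b \<times> 'a) tensor) \<Rightarrow>
   ('k, 'c::ab_group_add) hopf_data \<Rightarrow> ('c \<Rightarrow> 'b \<Rightarrow> 'c) \<Rightarrow>
   ('k \<Rightarrow> 'm::ab_group_add \<Rightarrow> 'm) \<Rightarrow> ('m \<Rightarrow> 'a \<Rightarrow> 'm) \<Rightarrow> ('m \<Rightarrow> ('k, 'c \<times> 'm) tensor) \<Rightarrow> bool" where
  "doi_hopf_module B A coA C ra sm act \<rho> \<longleftrightarrow>
     doi_hopf_datum B A coA C ra \<and>
     right_module A sm act \<and> left_comodule C sm \<rho> \<and>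
     (\<forall>m a. \<rho> (act m a) = tens2 (scl C) sm
        (sw (\<rho> m) (\<lambda>(c, m0). sw (coA a) (\<lambda>(b, a0). pure (ra c b, act m0 a0)))))"

definition doi_hopf_morphism ::
  "('k::field, 'b::ab_group_add) hopf_data \<Rightarrow>
   ('k, 'a::ab_group_add) hopf_data \<Rightarrow> ('a \<Rightarrow> ('k, 'b \<times> 'a) tensor) \<Rightarrow>
   ('k, 'c::ab_group_add) hopf_data \<Rightarrow> ('c \<Rightarrow> 'b \<Rightarrow> 'c) \<Rightarrow>
   ('k \<Rightarrow> 'm::ab_group_add \<Rightarrow> 'm) \<Rightarrow> ('m \<Rightarrow> 'a \<Rightarrow> 'm) \<Rightarrow> ('m \<Rightarrow> ('k, 'c \<times> 'm) tensor) \<Rightarrow>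
   ('k \<Rightarrow> 'n::ab_group_add \<Rightarrow> 'n) \<Rightarrow> ('n \<Rightarrow> 'a \<Rightarrow> 'n) \<Rightarrow> ('n \<Rightarrow> ('k, 'c \<times> 'n) tensor) \<Rightarrow>
   ('m \<Rightarrow> 'n) \<Rightarrow> bool" where
  "doi_hopf_morphism B A coA C ra sm actm \<rho>m sn actn \<rho>n f \<longleftrightarrow>
     doi_hopf_module B A coA C ra sm actm \<rho>m \<and>
     doi_hopf_module B A coA C ra sn actn \<rho>n \<and>
     Vector_Spaces.linear sm sn f \<and>
     (\<forall>m a. f (actm m a) = actn (f m) a) \<and>
     (\<forall>m. \<rho>n (f m) = tens2 (scl C) sn (sw (\<rho>m m) (\<lambda>(c, m0). pure (c, f m0))))"

end

(*
  A relative Rota-Baxter operator turns L into a Hopf algebra P = L_[pi]: its Galois map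
  a (x) b -> a_1 (x) a_2 o b is a composition of two maps that S_H and S_L invert, so the evident
  right convolution inverse of the identity is also a left one.

  For x in H and a in P put p = pi(x -> a) and q = x pi(a). Both are coalgebra maps from H (x) P
  to H, and x <- a = S(p_1) q_2. The Yetter-Drinfeld condition reads
  p_1 S(p_3) (x) (x -> a)_2 = q_1 S(q_3) (x) (x -> a)_2, which is equivalent to the exchange rule
  (x_1 <- a_1) (x) (x_2 -> a_2) = (x_2 <- a_2) (x) (x_1 -> a_1). Hence H and P form a matched pair:
  x -> (a o b) = (x_1 -> a_1) o ((x_2 <- a_2) -> b).

  The actions on H and on L are both instances of
  R(k, a) = S_K(theta(psi(k_1) -> a_1)) k_2 theta(a_2) for Hopf algebra maps psi : K -> H and
  theta : P -> K with psi theta = pi. Since S_K reverses coproducts and products, the exchange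
  rule gives (psi (x) id) Delta R(k, a) = (psi(k_1) <- a_1) (x) R(k_2, a_2), and with this and the
  matched pair identity R(R(k, a), b) = R(k, a o b).
*)

theory Submission
  imports Defs
begin

section \<open>Sweedler sums\<close>

abbreviation lin ::
  "('k::field \<Rightarrow> 'a::ab_group_add \<Rightarrow> 'a) \<Rightarrow> ('k \<Rightarrow> 'b::ab_group_add \<Rightarrow> 'b) \<Rightarrow> ('a \<Rightarrow> 'b) \<Rightarrow> bool" where
  "lin \<equiv> Vector_Spaces.linear"

text \<open>Currying the summand over the two legs keeps nested sums free of pair patterns, so that
  Fubini and coassociativity become equations between plain binders.\<close>

definition cosum ::
  "('k::field \<Rightarrow> 'c::ab_group_add \<Rightarrow> 'c) \<Rightarrow> ('k, 'a::ab_group_add) hopf_data \<Rightarrow> 'a \<Rightarrow>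
   ('a \<Rightarrow> 'a \<Rightarrow> 'c) \<Rightarrow> 'c" where
  "cosum s C x F = sweedler s (cop C x) (\<lambda>(a, b). F a b)"

lemma linI:
  assumes "vector_space s" "vector_space s'"
    and "\<And>x y. f (x + y) = f x + f y" "\<And>c x. f (s c x) = s' c (f x)"
  shows "lin s s' f"
  using assms by (simp add: Vector_Spaces.linear_iff)

lemma lin_comp: "lin s' s'' f \<Longrightarrow> lin s s' g \<Longrightarrow> lin s s'' (\<lambda>x. f (g x))"
  by (simp add: Vector_Spaces.linear_iff)

lemma lin_id: "vector_space s \<Longrightarrow> lin s s (\<lambda>x. x)"
  by (simp add: Vector_Spaces.linear_iff)

lemma lin_vsD: "lin s s' f \<Longrightarrow> vector_space s" "lin s s' f \<Longrightarrow> vector_space s'"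
  by (simp_all add: Vector_Spaces.linear_iff)

lemma lin_addD: "lin s s' f \<Longrightarrow> f (x + y) = f x + f y"
  by (simp add: Vector_Spaces.linear_iff)

lemma lin_scaleD: "lin s s' f \<Longrightarrow> f (s c x) = s' c (f x)"
  by (simp add: Vector_Spaces.linear_iff)

lemma lin_scale: "lin s s' f \<Longrightarrow> lin s s' (\<lambda>x. s' c (f x))"
  by (auto simp: Vector_Spaces.linear_iff vector_space_def algebra_simps)

lemma lin_scale_coeff: "vector_space s' \<Longrightarrow> lin s (*) g \<Longrightarrow> lin s s' (\<lambda>x. s' (g x) y)"
  by (auto simp: Vector_Spaces.linear_iff vector_space_def algebra_simps)

lemma vector_space_field: "vector_space ((*) :: 'k::field \<Rightarrow> 'k \<Rightarrow> 'k)"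
  by unfold_locales (auto simp: algebra_simps)

lemma bilinI: "(\<And>a. lin sb s (\<lambda>b. F a b)) \<Longrightarrow> (\<And>b. lin sa s (\<lambda>a. F a b)) \<Longrightarrow> bilin sa sb s F"
  by (simp add: bilin_def)

lemma bilinD: "bilin sa sb s F \<Longrightarrow> lin sb s (F a)" "bilin sa sb s F \<Longrightarrow> lin sa s (\<lambda>a. F a b)"
  by (simp_all add: bilin_def)

lemma lin_fextend: "vector_space s \<Longrightarrow> lin fscale s (fextend s F)"
  by (rule linear_fextend)

text \<open>A Sweedler sum is a finite linear combination over one fixed representative of the
  tensor, so a linear map passes through it for any summand.\<close>

lemma lin_sweedler:
  assumes h: "lin s s' h"
  shows "h (sweedler s t F) = sweedler s' t (\<lambda>p. h (F p))"
proof -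
  interpret h: Vector_Spaces.linear s s' h by fact
  show ?thesis by (simp add: sweedler_def fextend_def h.sum h.scale)
qed

lemma lin_cosum: "lin s s' h \<Longrightarrow> h (cosum s C x F) = cosum s' C x (\<lambda>a b. h (F a b))"
  unfolding cosum_def by (subst lin_sweedler[of s s' h]) (auto simp: case_prod_beta')

lemma fextend_sw:
  assumes "vector_space s"
  shows "fextend s F (sw t G) = sweedler s t (\<lambda>p. fextend s F (G p))"
  by (rule lin_sweedler[OF lin_fextend[OF assms]])

lemma fextend_sw_pair:
  assumes "vector_space s"
  shows "fextend s F (sw t (\<lambda>(a, b). G a b)) = sweedler s t (\<lambda>(a, b). fextend s F (G a b))"
  by (subst fextend_sw[OF assms]) (auto simp: case_prod_beta')

lemma fextend_sw_cosum:
  assumes "vector_space s"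
  shows "fextend s F (sw (cop C x) (\<lambda>(a, b). G a b)) = cosum s C x (\<lambda>a b. fextend s F (G a b))"
  by (subst fextend_sw_pair[OF assms]) (simp add: cosum_def)

lemma lin_sweedler_body:
  assumes "vector_space s0" "vector_space s" "\<And>p. lin s0 s (\<lambda>x. F x p)"
  shows "lin s0 s (\<lambda>x. sweedler s t (F x))"
proof -
  interpret s: vector_space s by fact
  have F: "F (x + y) p = F x p + F y p" "F (s0 c x) p = s c (F x p)" for x y p c
    using assms(3)[of p] by (simp_all add: Vector_Spaces.linear_iff)
  show ?thesis unfolding sweedler_def fextend_def
    by (intro linI assms)
      (simp_all add: F s.scale_right_distrib sum.distrib s.scale_sum_right mult.commute)
qed

lemma lin_cosum_body:
  assumes "vector_space s0" "vector_space s" "\<And>a b. lin s0 s (\<lambda>x. F x a b)"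
  shows "lin s0 s (\<lambda>x. cosum s C c (F x))"
  unfolding cosum_def by (rule lin_sweedler_body) (auto simp: assms case_prod_beta')

text \<open>Fubini: with both representatives fixed, this is an exchange of two finite sums.\<close>

lemma sweedler_swap:
  assumes "vector_space s"
  shows "sweedler s t (\<lambda>p. sweedler s u (F p)) = sweedler s u (\<lambda>q. sweedler s t (\<lambda>p. F p q))"
proof -
  interpret s: vector_space s by fact
  show ?thesis
    unfolding sweedler_def fextend_def s.scale_sum_right s.scale_scale
    by (subst sum.swap) (simp add: mult.commute)
qed

lemma cosum_swap:
  assumes "vector_space s"
  shows "cosum s C x (\<lambda>a b. cosum s D y (\<lambda>c d. F a b c d)) =
    cosum s D y (\<lambda>c d. cosum s C x (\<lambda>a b. F a b c d))"
  using sweedler_swap[OF assms, of "cop C x" "cop D y" "\<lambda>(a, b) (c, d). F a b c d"]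
  by (simp add: cosum_def case_prod_beta')

lemma cosum_scale:
  assumes "vector_space s"
  shows "cosum s C x (\<lambda>a b. s c (F a b)) = s c (cosum s C x F)"
  using lin_cosum[OF lin_scale[OF lin_id[OF assms]], of c C x F] by simp

section \<open>Equality of tensors\<close>

text \<open>Adding \<open>v\<close> to a basis of the span of \<open>R\<close> leaves it
  independent, so a functional can be prescribed as 1 at \<open>v\<close> and 0 on that basis. It
  will separate formal sums that define different tensors.\<close>

lemma exists_functional:
  assumes "vector_space s" and v: "v \<notin> module.span s R"
  shows "\<exists>\<phi>. lin s (*) \<phi> \<and> (\<forall>r\<in>R. \<phi> r = 0) \<and> \<phi> v = (1 :: 'k::field)"
proof -
  interpret V: vector_space s by fact
  interpret W: vector_space "(*) :: 'k \<Rightarrow> 'k \<Rightarrow> 'k" by (rule vector_space_field)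
  interpret VW: vector_space_pair s "(*) :: 'k \<Rightarrow> 'k \<Rightarrow> 'k"
    by (rule vector_space_pair.intro) (rule assms vector_space_field)+
  obtain B where B: "B \<subseteq> R" "V.independent B" "R \<subseteq> V.span B"
    using V.maximal_independent_subset[of R] by blast
  have "V.span B = V.span R"
    using B by (metis V.span_mono V.span_minimal V.subspace_span subset_antisym)
  then have "V.independent (insert v B)"
    using v B(2) by (simp add: V.independent_insertI)
  from VW.linear_independent_extend[OF this, of "\<lambda>x. if x = v then 1 else 0"] obtain \<phi> where
    \<phi>: "lin s (*) \<phi>" "\<And>x. x \<in> insert v B \<Longrightarrow> \<phi> x = (if x = v then 1 else 0)"
    by blast
  interpret \<phi>: Vector_Spaces.linear s "(*)" \<phi> by fact
  have "v \<notin> B" using B(1) v V.span_base by blast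
  then have "\<phi> x = 0" if "x \<in> V.span B" for x
    using that \<phi>(2) by (intro \<phi>.eq_0_on_span[OF _ that]) auto
  then show ?thesis using \<phi> B(3) by (intro exI[of _ \<phi>]) auto
qed

lemma coset_eqI:
  assumes "x - y \<in> module.span fscale R"
  shows "{g. g - x \<in> module.span fscale R} = {g. g - y \<in> module.span fscale R}"
proof -
  interpret FS: vector_space fscale by (rule vector_space_fscale)
  have "g - x \<in> FS.span R \<longleftrightarrow> g - y \<in> FS.span R" for g
    using FS.span_add[OF _ assms, of "g - x"] FS.span_diff[OF _ assms, of "g - y"] by auto
  then show ?thesis by blast
qed

lemma fextend_functional:
  assumes "lin fscale (*) \<phi>"
  shows "fextend (*) (\<lambda>x. \<phi> (pure x)) f = \<phi> f"
proof -
  interpret \<phi>: Vector_Spaces.linear fscale "(*)" \<phi> by fact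
  have "fextend (*) (\<lambda>x. \<phi> (pure x)) f
      = \<phi> (\<Sum>x\<in>Poly_Mapping.keys f. fscale (Poly_Mapping.lookup f x) (pure x))"
    by (simp add: fextend_def \<phi>.sum \<phi>.scale)
  also have "(\<Sum>x\<in>Poly_Mapping.keys f. fscale (Poly_Mapping.lookup f x) (pure x)) = f"
    by (rule poly_mapping_eqI)
      (simp add: lookup_sum lookup_single when_def in_keys_iff if_distrib cong: if_cong)
  finally show ?thesis .
qed

lemma relations2I:
  "pure (a + a', b) - pure (a, b) - pure (a', b) \<in> relations2 sa sb"
  "pure (a, b + b') - pure (a, b) - pure (a, b') \<in> relations2 sa sb"
  "pure (sa c a, b) - fscale c (pure (a, b)) \<in> relations2 sa sb"
  "pure (a, sb c b) - fscale c (pure (a, b)) \<in> relations2 sa sb"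
  unfolding relations2_def by blast+

lemma relations3I:
  "pure (a + a', b, c) - pure (a, b, c) - pure (a', b, c) \<in> relations3 sa sb sc"
  "pure (a, b + b', c) - pure (a, b, c) - pure (a, b', c) \<in> relations3 sa sb sc"
  "pure (a, b, c + c') - pure (a, b, c) - pure (a, b, c') \<in> relations3 sa sb sc"
  "pure (sa r a, b, c) - fscale r (pure (a, b, c)) \<in> relations3 sa sb sc"
  "pure (a, sb r b, c) - fscale r (pure (a, b, c)) \<in> relations3 sa sb sc"
  "pure (a, b, sc r c) - fscale r (pure (a, b, c)) \<in> relations3 sa sb sc"
  unfolding relations3_def
  subgoal by ((rule UnI1)+, blast)
  subgoal by ((rule UnI1, rule UnI1, rule UnI1, rule UnI1, rule UnI2), blast)
  subgoal by ((rule UnI1, rule UnI1, rule UnI1, rule UnI2), blast)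
  subgoal by ((rule UnI1, rule UnI1, rule UnI2), blast)
  subgoal by ((rule UnI1, rule UnI2), blast)
  subgoal by (rule UnI2, blast)
  done

text \<open>If the classes differed, some functional would vanish on the relations but not on the
  difference. Its values on pure tensors form a bilinear form telling \<open>f\<close> and
  \<open>g\<close> apart. Tensor identities are thus reduced to scalar identities.\<close>

lemma tens2_eqI:
  fixes f g :: "('a::ab_group_add \<times> 'b::ab_group_add) \<Rightarrow>\<^sub>0 'k::field"
  assumes vs: "vector_space sa" "vector_space sb"
    and eq: "\<And>B. bilin sa sb (*) B \<Longrightarrow> fextend (*) (\<lambda>(a, b). B a b) f =
      fextend (*) (\<lambda>(a, b). B a b) g"
  shows "tens2 sa sb f = tens2 sa sb g"
proof (rule ccontr)
  interpret FS: vector_space fscale by (rule vector_space_fscale)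
  assume "tens2 sa sb f \<noteq> tens2 sa sb g"
  then have "f - g \<notin> FS.span (relations2 sa sb)"
    using coset_eqI[of f g] unfolding tens2_def by blast
  from exists_functional[OF vector_space_fscale this] obtain \<phi> where
    \<phi>: "lin fscale (*) \<phi>" "\<And>r. r \<in> relations2 sa sb \<Longrightarrow> \<phi> r = 0" "\<phi> (f - g) = (1 :: 'k)"
    by blast
  interpret \<phi>: Vector_Spaces.linear fscale "(*)" \<phi> by fact
  have "\<phi> (pure (a + a', b)) = \<phi> (pure (a, b)) + \<phi> (pure (a', b))" for a a' b
    using \<phi>(2)[OF relations2I(1)] by (simp add: \<phi>.diff \<phi>.add \<phi>.scale algebra_simps)
  moreover have "\<phi> (pure (a, b + b')) = \<phi> (pure (a, b)) + \<phi> (pure (a, b'))" for a b b'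
    using \<phi>(2)[OF relations2I(2)] by (simp add: \<phi>.diff \<phi>.add \<phi>.scale algebra_simps)
  moreover have "\<phi> (pure (sa c a, b)) = c * \<phi> (pure (a, b))" for a b c
    using \<phi>(2)[OF relations2I(3)] by (simp add: \<phi>.diff \<phi>.add \<phi>.scale algebra_simps)
  moreover have "\<phi> (pure (a, sb c b)) = c * \<phi> (pure (a, b))" for a b c
    using \<phi>(2)[OF relations2I(4)] by (simp add: \<phi>.diff \<phi>.add \<phi>.scale algebra_simps)
  ultimately have "bilin sa sb (*) (\<lambda>a b. \<phi> (pure (a, b)))"
    by (intro bilinI linI vs vector_space_field) auto
  from eq[OF this] have "\<phi> f = \<phi> g"
    using fextend_functional[OF \<phi>(1)] by (simp add: case_prod_beta')
  then show False using \<phi>(3) by (simp add: \<phi>.diff)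
qed

definition trilin ::
  "('k::field \<Rightarrow> 'a::ab_group_add \<Rightarrow> 'a) \<Rightarrow> ('k \<Rightarrow> 'b::ab_group_add \<Rightarrow> 'b) \<Rightarrow>
   ('k \<Rightarrow> 'c::ab_group_add \<Rightarrow> 'c) \<Rightarrow> ('k \<Rightarrow> 'd::ab_group_add \<Rightarrow> 'd) \<Rightarrow> ('a \<Rightarrow> 'b \<Rightarrow> 'c \<Rightarrow> 'd) \<Rightarrow> bool" where
  "trilin sa sb sc s F \<longleftrightarrow>
     (\<forall>b c. lin sa s (\<lambda>a. F a b c)) \<and> (\<forall>a c. lin sb s (\<lambda>b. F a b c)) \<and> (\<forall>a b. lin sc s (\<lambda>c.
       F a b c))"

text \<open>A trilinear map kills the relations and so factors through the quotient. This direction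
  makes a given tensor identity, such as coassociativity, usable under any trilinear
  summand.\<close>

lemma tens3_eqD:
  assumes eq: "tens3 sa sb sc f = tens3 sa sb sc g"
    and F: "trilin sa sb sc s F"
  shows "fextend s (\<lambda>(a, b, c). F a b c) f = fextend s (\<lambda>(a, b, c). F a b c) g"
proof -
  interpret FS: vector_space fscale by (rule vector_space_fscale)
  have vs: "vector_space s" using F by (auto simp: trilin_def dest: lin_vsD)
  let ?E = "fextend s (\<lambda>(a, b, c). F a b c)"
  interpret E: Vector_Spaces.linear fscale s ?E by (rule linear_fextend[OF vs])
  have eqs: "F (a + a') b c = F a b c + F a' b c" "F a (b + b') c = F a b c + F a b' c"
    "F a b (c + c') = F a b c + F a b c'" "F (sa r a) b c = s r (F a b c)"
    "F a (sb r b) c = s r (F a b c)" "F a b (sc r c) = s r (F a b c)" for a a' b b' c c' r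
    using F unfolding trilin_def Vector_Spaces.linear_iff by blast+
  have rel: "?E r = 0" if "r \<in> relations3 sa sb sc" for r
    using that unfolding relations3_def
    by (elim UnE CollectE exE conjE) (simp_all add: E.diff E.scale fextend_pure[OF vs] eqs)
  have "f \<in> tens3 sa sb sc f"
    by (simp add: tens3_def FS.span_zero)
  then have "f \<in> tens3 sa sb sc g"
    unfolding eq .
  then have "f - g \<in> FS.span (relations3 sa sb sc)" by (simp add: tens3_def)
  then have "?E (f - g) = 0"
    by (rule FS.span_induct_alt) (auto simp: E.add E.scale rel)
  then show ?thesis by (simp add: E.diff)
qed

text \<open>The separating functional of \<open>tens2_eqI\<close>, now giving a trilinear
  form.\<close>

lemma tens3_eqI:
  fixes f g :: "('a::ab_group_add \<times> 'b::ab_group_add \<times> 'c::ab_group_add) \<Rightarrow>\<^sub>0 'k::field"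
  assumes vs: "vector_space sa" "vector_space sb" "vector_space sc"
    and eq: "\<And>B. trilin sa sb sc (*) B \<Longrightarrow>
      fextend (*) (\<lambda>(a, b, c). B a b c) f = fextend (*) (\<lambda>(a, b, c). B a b c) g"
  shows "tens3 sa sb sc f = tens3 sa sb sc g"
proof (rule ccontr)
  interpret FS: vector_space fscale by (rule vector_space_fscale)
  assume "tens3 sa sb sc f \<noteq> tens3 sa sb sc g"
  then have "f - g \<notin> FS.span (relations3 sa sb sc)"
    using coset_eqI[of f g] unfolding tens3_def by blast
  from exists_functional[OF vector_space_fscale this] obtain \<phi> where
    \<phi>: "lin fscale (*) \<phi>" "\<And>r. r \<in> relations3 sa sb sc \<Longrightarrow> \<phi> r = 0" "\<phi> (f - g) = (1 :: 'k)"
    by blast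
  interpret \<phi>: Vector_Spaces.linear fscale "(*)" \<phi> by fact
  have "\<phi> (pure (a + a', b, c)) = \<phi> (pure (a, b, c)) + \<phi> (pure (a', b, c))" for a a' b c
    using \<phi>(2)[OF relations3I(1)] by (simp add: \<phi>.diff \<phi>.add \<phi>.scale algebra_simps)
  moreover have "\<phi> (pure (a, b + b', c)) = \<phi> (pure (a, b, c)) + \<phi> (pure (a, b', c))" for a b b' c
    using \<phi>(2)[OF relations3I(2)] by (simp add: \<phi>.diff \<phi>.add \<phi>.scale algebra_simps)
  moreover have "\<phi> (pure (a, b, c + c')) = \<phi> (pure (a, b, c)) + \<phi> (pure (a, b, c'))" for a b c c'
    using \<phi>(2)[OF relations3I(3)] by (simp add: \<phi>.diff \<phi>.add \<phi>.scale algebra_simps)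
  moreover have "\<phi> (pure (sa r a, b, c)) = r * \<phi> (pure (a, b, c))" for a b c r
    using \<phi>(2)[OF relations3I(4)] by (simp add: \<phi>.diff \<phi>.add \<phi>.scale algebra_simps)
  moreover have "\<phi> (pure (a, sb r b, c)) = r * \<phi> (pure (a, b, c))" for a b c r
    using \<phi>(2)[OF relations3I(5)] by (simp add: \<phi>.diff \<phi>.add \<phi>.scale algebra_simps)
  moreover have "\<phi> (pure (a, b, sc r c)) = r * \<phi> (pure (a, b, c))" for a b c r
    using \<phi>(2)[OF relations3I(6)] by (simp add: \<phi>.diff \<phi>.add \<phi>.scale algebra_simps)
  ultimately have "trilin sa sb sc (*) (\<lambda>a b c. \<phi> (pure (a, b, c)))"
    unfolding trilin_def by (intro conjI allI linI vs vector_space_field) auto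
  from eq[OF this] have "\<phi> f = \<phi> g"
    using fextend_functional[OF \<phi>(1)] by (simp add: case_prod_beta')
  then show False using \<phi>(3) by (simp add: \<phi>.diff)
qed

declare vector_space_field [simp]
declare lin_id [simp] lin_cosum_body [simp]

lemma lin_mult_field [simp]:
  "lin s (*) g \<Longrightarrow> lin s (*) (\<lambda>x. g x * c)" "lin s (*) g \<Longrightarrow> lin s (*) (\<lambda>x. c * g x)"
  for c :: "'k::field"
  by (auto simp: Vector_Spaces.linear_iff algebra_simps)

section \<open>Coalgebras, algebras, Hopf algebras\<close>

locale coalg =
  fixes C :: "('k::field, 'c::ab_group_add) hopf_data"
  assumes coalgebra: "is_coalgebra C"
begin

lemma vs [simp]: "vector_space (scl C)"
  using coalgebra by (simp add: is_coalgebra_def)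

lemma lin_cou: "lin (scl C) (*) (cou C)"
  using coalgebra by (simp add: is_coalgebra_def)

text \<open>The choice \<open>rep\<close> is not linear. A bilinear summand has the same value on
  every representative, though, and \<open>tensor_linear\<close> expresses sums and multiples of
  classes through representatives.\<close>

lemma lin_cosum_arg:
  assumes "\<And>a. lin (scl C) s (F a)" "\<And>b. lin (scl C) s (\<lambda>a. F a b)"
  shows "lin (scl C) s (\<lambda>x. cosum s C x F)"
proof -
  have vs': "vector_space s" using assms(1) by (rule lin_vsD)
  interpret E: Vector_Spaces.linear fscale s "fextend s (\<lambda>(a, b). F a b)"
    by (rule linear_fextend[OF vs'])
  have bl: "bilin (scl C) (scl C) s F" using assms by (simp add: bilin_def)
  have tl: "tensor_linear (scl C) (scl C) (scl C) (cop C)"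
    using coalgebra by (simp add: is_coalgebra_def)
  have "cosum s C x F = fextend s (\<lambda>(a, b). F a b) (rep (cop C x))" for x
    by (simp add: cosum_def sweedler_def)
  then show ?thesis
    using tl sweedler_tens2[OF bl] unfolding tensor_linear_def cosum_def
    by (intro linI) (auto simp: E.add E.scale vs')
qed

lemma lin_cosum_comp:
  assumes "lin s0 (scl C) g" "\<And>a. lin (scl C) s (\<lambda>b. F a b)" "\<And>b. lin (scl C) s (\<lambda>a. F a b)"
  shows "lin s0 s (\<lambda>x. cosum s C (g x) (\<lambda>a b. F a b))"
  using assms by (intro lin_comp[OF lin_cosum_arg])

text \<open>Coassociativity tested against a trilinear map. Read from left to right it moves a
  nested coproduct from the left leg to the right leg, which makes it a normalising rewrite
  rule.\<close>

lemma cosum_coassoc: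
  assumes "\<And>b c. lin (scl C) s (\<lambda>a. F a b c)" "\<And>a c. lin (scl C) s (\<lambda>b. F a b c)"
    "\<And>a b. lin (scl C) s (\<lambda>c. F a b c)"
  shows "cosum s C x (\<lambda>y c. cosum s C y (\<lambda>a b. F a b c)) =
    cosum s C x (\<lambda>a y. cosum s C y (\<lambda>b c. F a b c))"
proof -
  have tl: "trilin (scl C) (scl C) (scl C) s F" using assms by (simp add: trilin_def)
  have vs': "vector_space s" using assms(1) by (rule lin_vsD)
  have "tens3 (scl C) (scl C) (scl C)
            (sw (cop C x) (\<lambda>(y, x3). sw (cop C y) (\<lambda>(x1, x2). pure (x1, x2, x3)))) =
          tens3 (scl C) (scl C) (scl C)
            (sw (cop C x) (\<lambda>(x1, y). sw (cop C y) (\<lambda>(x2, x3). pure (x1, x2, x3))))"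
    using coalgebra by (simp add: is_coalgebra_def)
  from tens3_eqD[OF this tl] show ?thesis
    by (simp add: fextend_sw_cosum[OF vs'] fextend_pure[OF vs'])
qed

lemma cosum_counit_self:
  "cosum (scl C) C x (\<lambda>a b. scl C (cou C a) b) = x"
    "cosum (scl C) C x (\<lambda>a b. scl C (cou C b) a) = x"
  using coalgebra by (auto simp: is_coalgebra_def cosum_def)

lemma cosum_counit:
  assumes "lin (scl C) s h"
  shows "cosum s C x (\<lambda>a b. s (cou C a) (h b)) = h x" "cosum s C x (\<lambda>a b. s (cou C b) (h a)) = h x"
proof -
  interpret h: Vector_Spaces.linear "scl C" s h by fact
  show "cosum s C x (\<lambda>a b. s (cou C a) (h b)) = h x" "cosum s C x (\<lambda>a b. s (cou C b) (h a)) = h x"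
    using lin_cosum[OF assms, of C x "\<lambda>a b. scl C (cou C a) b"]
      lin_cosum[OF assms, of C x "\<lambda>a b. scl C (cou C b) a"]
    by (simp_all add: cosum_counit_self h.scale)
qed

text \<open>
  Fubini for Sweedler sums is not a terminating rewrite rule. The rules \<open>cosum_gather\<close> apply it only
  in order to move the coproduct of a component up to the coproduct that produced this component,
  so that \<open>cosum_coassoc\<close> can bring the iterated coproduct into right-nested form.
\<close>

lemma cosum_out1:
  assumes "vector_space s"
  shows "cosum s C e1 (\<lambda>p q. cosum s C y (\<lambda>a b. F p q a b)) =
    cosum s C y (\<lambda>a b. cosum s C e1 (\<lambda>p q. F p q a b))"
  by (simp only: cosum_swap[OF assms, of C _ C y])

lemma cosum_out2:
  assumes "vector_space s"
  shows "cosum s C e1 (\<lambda>p q. cosum s C (e2 p q) (\<lambda>r t. cosum s C y (\<lambda>a b. F p q r t a b))) =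
    cosum s C y (\<lambda>a b. cosum s C e1 (\<lambda>p q. cosum s C (e2 p q) (\<lambda>r t. F p q r t a b)))"
  by (simp only: cosum_swap[OF assms, of C _ C y])

lemma cosum_gather_left1:
  assumes "vector_space s"
  shows "cosum s C x (\<lambda>y c. cosum s C (e1 y c) (\<lambda>p q. cosum s C y (\<lambda>a b. F y c p q a b))) =
    cosum s C x (\<lambda>y c. cosum s C y (\<lambda>a b. cosum s C (e1 y c) (\<lambda>p q. F y c p q a b)))"
  by (rule arg_cong[where f = "cosum s C x"], intro ext, rule cosum_out1[OF assms])

lemma cosum_gather_right1:
  assumes "vector_space s"
  shows "cosum s C x (\<lambda>y c. cosum s C e1 (\<lambda>p q. cosum s C c (\<lambda>a b. F y c p q a b))) =
    cosum s C x (\<lambda>y c. cosum s C c (\<lambda>a b. cosum s C e1 (\<lambda>p q. F y c p q a b)))"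
  by (rule arg_cong[where f = "cosum s C x"], intro ext, rule cosum_out1[OF assms])

lemma cosum_gather_left2:
  assumes "vector_space s"
  shows "cosum s C x (\<lambda>y c. cosum s C (e1 y c) (\<lambda>p q. cosum s C (e2 y c p q) (\<lambda>r t.
    cosum s C y (\<lambda>a b. F y c p q r t a b)))) =
    cosum s C x (\<lambda>y c. cosum s C y (\<lambda>a b. cosum s C (e1 y c) (\<lambda>p q.
      cosum s C (e2 y c p q) (\<lambda>r t. F y c p q r t a b))))"
  by (rule arg_cong[where f = "cosum s C x"], intro ext, rule cosum_out2[OF assms])

lemma cosum_gather_right2:
  assumes "vector_space s"
  shows "cosum s C x (\<lambda>y c. cosum s C e1 (\<lambda>p q. cosum s C (e2 p q) (\<lambda>r t.
    cosum s C c (\<lambda>a b. F y c p q r t a b)))) =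
    cosum s C x (\<lambda>y c. cosum s C c (\<lambda>a b. cosum s C e1 (\<lambda>p q.
      cosum s C (e2 p q) (\<lambda>r t. F y c p q r t a b))))"
  by (rule arg_cong[where f = "cosum s C x"], intro ext, rule cosum_out2[OF assms])

lemmas cosum_gather =
  cosum_gather_left1 cosum_gather_left2 cosum_gather_right1 cosum_gather_right2

text \<open>A coproduct is the class of some formal sum, so scalar-valued bilinear forms determine
  it by \<open>tens2_eqI\<close>.\<close>

lemma cop_eqI:
  assumes "\<And>B. bilin (scl C) (scl C) (*) B \<Longrightarrow> cosum (*) C x B = fextend (*) (\<lambda>(a, b). B a b) g"
  shows "cop C x = tens2 (scl C) (scl C) g"
proof -
  have "cop C x \<in> range (tens2 (scl C) (scl C))"
    using coalgebra by (simp add: is_coalgebra_def tensor_linear_def)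
  then obtain f where f: "cop C x = tens2 (scl C) (scl C) f" by blast
  have "tens2 (scl C) (scl C) f = tens2 (scl C) (scl C) g"
    using assms by (intro tens2_eqI vs) (simp add: cosum_def f sweedler_tens2)
  then show ?thesis using f by simp
qed

lemma lin_cou_comp [simp]: "lin s (scl C) g \<Longrightarrow> lin s (*) (\<lambda>x. cou C (g x))"
  by (rule lin_comp[OF lin_cou])

lemmas lin_scale_self [simp] =
  lin_scale[where s' = "scl C"] lin_scale_coeff[where s' = "scl C", OF vs]

lemmas cosum_scale_self [simp] = cosum_scale[where s = "scl C", OF vs]

declare lin_cosum_comp [simp]

lemmas cosum_counit_simps [simp] =
  cosum_counit[where s = "scl C"] cosum_counit[where s = "(*)"]

end

locale alg =
  fixes A :: "('k::field, 'a::ab_group_add) hopf_data"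
  assumes algebra: "is_algebra A"
begin

lemma vs_alg [simp]: "vector_space (scl A)"
  using algebra by (simp add: is_algebra_def)

lemma lin_mul [simp]:
  "lin s (scl A) g \<Longrightarrow> lin s (scl A) (\<lambda>x. mul A (g x) b)"
  "lin s (scl A) g \<Longrightarrow> lin s (scl A) (\<lambda>x. mul A b (g x))"
  using algebra by (auto simp: is_algebra_def bilin_def intro: lin_comp)

lemma mul_scale [simp]:
  "mul A (scl A c a) b = scl A c (mul A a b)" "mul A a (scl A c b) = scl A c (mul A a b)"
  using algebra by (auto simp: is_algebra_def bilin_def Vector_Spaces.linear_iff)

lemma mul_cosum:
  "mul A (cosum (scl A) C x F) b = cosum (scl A) C x (\<lambda>u v. mul A (F u v) b)"
  "mul A b (cosum (scl A) C x F) = cosum (scl A) C x (\<lambda>u v. mul A b (F u v))"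
  by (rule lin_cosum, simp)+

lemma mul_assoc: "mul A (mul A a b) c = mul A a (mul A b c)"
  and one_mul [simp]: "mul A (one A) a = a" and mul_one [simp]: "mul A a (one A) = a"
  using algebra by (simp_all add: is_algebra_def)

end

lemma coalgebra_hom_cosum:
  assumes f: "coalgebra_hom C D f" and F: "\<And>a. lin (scl D) s (F a)" "\<And>b. lin (scl D) s (\<lambda>a. F a b)"
  shows "cosum s D (f x) F = cosum s C x (\<lambda>a b. F (f a) (f b))"
proof -
  have bl: "bilin (scl D) (scl D) s F" using F by (simp add: bilin_def)
  have vs: "vector_space s" using F(1) by (rule lin_vsD)
  show ?thesis using f
    by (simp add: coalgebra_hom_def cosum_def[of s D] sweedler_tens2[OF bl] fextend_sw_cosum[OF vs]
        fextend_pure[OF vs])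
qed

text \<open>Compatibility of product and coproduct is left out on purpose: for the braided Hopf
  algebra \<open>L\<close> it takes a twisted form, while the facts collected here hold for
  \<open>H\<close> and \<open>L\<close> alike.\<close>

locale antipode_alg = alg H + coalg H
  for H :: "('k::field, 'h::ab_group_add) hopf_data" +
  assumes antipode: "is_antipode H"
begin

lemma lin_ant [simp]: "lin s (scl H) g \<Longrightarrow> lin s (scl H) (\<lambda>x. ant H (g x))"
  using antipode by (auto simp: is_antipode_def intro: lin_comp)

lemma ant_scale [simp]: "ant H (scl H c x) = scl H c (ant H x)"
  by (rule lin_scaleD[OF lin_ant]) simp

lemma cosum_ant:
  assumes h: "lin (scl H) s h"
  shows "cosum s H x (\<lambda>a b. h (mul H (ant H a) b)) = s (cou H x) (h (one H))"
    and "cosum s H x (\<lambda>a b. h (mul H a (ant H b))) = s (cou H x) (h (one H))"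
proof -
  interpret h: Vector_Spaces.linear "scl H" s h by fact
  have "cosum (scl H) H x (\<lambda>a b. mul H (ant H a) b) = scl H (cou H x) (one H)"
    and "cosum (scl H) H x (\<lambda>a b. mul H a (ant H b)) = scl H (cou H x) (one H)"
    using antipode by (simp_all add: is_antipode_def cosum_def)
  with lin_cosum[OF h, of H x "\<lambda>a b. mul H (ant H a) b"]
    lin_cosum[OF h, of H x "\<lambda>a b. mul H a (ant H b)"]
  show "cosum s H x (\<lambda>a b. h (mul H (ant H a) b)) = s (cou H x) (h (one H))"
    and "cosum s H x (\<lambda>a b. h (mul H a (ant H b))) = s (cou H x) (h (one H))"
    by (simp_all add: h.scale)
qed

text \<open>Coassociativity puts the first two legs into one coproduct, where the antipode axiom
  leaves a counit; the third leg absorbs it.\<close>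

lemma cosum2_ant:
  assumes G: "\<And>a. lin (scl H) s (\<lambda>b. G a b)" "\<And>b. lin (scl H) s (\<lambda>a. G a b)"
  shows "cosum s H x (\<lambda>a y. cosum s H y (\<lambda>b c. G (mul H (ant H a) b) c)) = G (one H) x"
    and "cosum s H x (\<lambda>a y. cosum s H y (\<lambda>b c. G (mul H a (ant H b)) c)) = G (one H) x"
proof -
  have [simp]: "vector_space s" using G(1) by (rule lin_vsD)
  note [simp] = lin_comp[OF G(1)] lin_comp[OF G(2)]
  note * = cosum_ant[OF G(2)] cosum_counit(1)[OF G(1)]
  show "cosum s H x (\<lambda>a y. cosum s H y (\<lambda>b c. G (mul H (ant H a) b) c)) = G (one H) x"
    by (subst cosum_coassoc[symmetric]) (simp_all add: *)
  show "cosum s H x (\<lambda>a y. cosum s H y (\<lambda>b c. G (mul H a (ant H b)) c)) = G (one H) x"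
    by (subst cosum_coassoc[symmetric]) (simp_all add: *)
qed

end

section \<open>Ordinary Hopf algebras: the antipode reverses products and coproducts\<close>

locale hopf_alg =
  fixes H :: "('k::field, 'h::ab_group_add) hopf_data"
  assumes hopf: "is_hopf H"
begin

sublocale antipode_alg H
  using hopf by unfold_locales (simp_all add: is_hopf_def)

lemma cou_mul [simp]: "cou H (mul H x y) = cou H x * cou H y"
  and cou_one [simp]: "cou H (one H) = 1"
  using hopf by (simp_all add: is_hopf_def)

lemma cosum_mul:
  assumes F: "\<And>a. lin (scl H) s (\<lambda>b. F a b)" "\<And>b. lin (scl H) s (\<lambda>a. F a b)"
  shows "cosum s H (mul H x y) (\<lambda>a b. F a b) =
    cosum s H x (\<lambda>x1 x2. cosum s H y (\<lambda>y1 y2. F (mul H x1 y1) (mul H x2 y2)))"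
proof -
  have bl: "bilin (scl H) (scl H) s F" using F by (simp add: bilin_def)
  have vs: "vector_space s" using F(1) by (rule lin_vsD)
  have "cop H (mul H x y) = tens2 (scl H) (scl H)
        (sw (cop H x) (\<lambda>(x1, x2). sw (cop H y) (\<lambda>(y1, y2). pure (mul H x1 y1, mul H x2 y2))))"
    using hopf by (simp add: is_hopf_def)
  then show ?thesis
    by (simp add: cosum_def[of s H "mul H x y"] sweedler_tens2[OF bl] fextend_sw_cosum[OF vs]
        fextend_pure[OF vs])
qed

lemma cosum_one:
  assumes F: "\<And>a. lin (scl H) s (\<lambda>b. F a b)" "\<And>b. lin (scl H) s (\<lambda>a. F a b)"
  shows "cosum s H (one H) (\<lambda>a b. F a b) = F (one H) (one H)"
proof -
  have bl: "bilin (scl H) (scl H) s F" using F by (simp add: bilin_def)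
  have vs: "vector_space s" using F(1) by (rule lin_vsD)
  have "cop H (one H) = tens2 (scl H) (scl H) (pure (one H, one H))"
    using hopf by (simp add: is_hopf_def)
  then show ?thesis
    by (simp add: cosum_def[of s H "one H"] sweedler_tens2[OF bl] fextend_pure[OF vs])
qed

lemma ant_one [simp]: "ant H (one H) = one H"
proof -
  interpret V: vector_space "scl H" by simp
  have "cosum (scl H) H (one H) (\<lambda>a b. mul H (ant H a) b) = ant H (one H)"
    by (simp add: cosum_one)
  then show ?thesis using cosum_ant(1)[of "scl H" "\<lambda>x. x" "one H"] by simp
qed

lemma cou_ant [simp]: "cou H (ant H x) = cou H x"
  using cosum_ant(1)[OF lin_cou, of x] cosum_counit(2)[of "(*)" "\<lambda>x. cou H (ant H x)" x]
  by (simp add: mult.commute)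

text \<open>Both sides are convolution inverses of the multiplication on H (x) H. The sum
  \<open>?E\<close> is built from S(x_1 y_1), x_2 y_2 and S(y_3) S(x_3): collapsing the last two
  factors leaves S(xy), collapsing the first two leaves S(y) S(x).\<close>

lemma ant_mul: "ant H (mul H x y) = mul H (ant H y) (ant H x)"
proof -
  interpret V: vector_space "scl H" by simp
  let ?s = "scl H"
  let ?E = "cosum ?s H x (\<lambda>x1 x'. cosum ?s H y (\<lambda>y1 y'. cosum ?s H x' (\<lambda>x2 x3.
    cosum ?s H y' (\<lambda>y2 y3.
     mul H (ant H (mul H x1 y1)) (mul H x2 (mul H y2 (mul H (ant H y3) (ant H x3))))))))"
  have "?E = cosum ?s H x (\<lambda>x1 x'. cosum ?s H y (\<lambda>y1 y'. cosum ?s H x' (\<lambda>x2 x3.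
     scl H (cou H y') (mul H (ant H (mul H x1 y1)) (mul H x2 (ant H x3))))))"
    using cosum_ant(2)[of ?s "\<lambda>z. mul H (ant H (mul H _ _)) (mul H _ (mul H z (ant H _)))"]
    by (simp add: mul_assoc)
  also have "\<dots> = ant H (mul H x y)"
    using cosum_ant(2)[of ?s "\<lambda>z. mul H (ant H (mul H _ _)) z"]
      cosum_counit(2)[of ?s "\<lambda>y1. ant H (mul H _ y1)"]
        cosum_counit(2)[of ?s "\<lambda>x1. ant H (mul H x1 _)"]
    by (simp add: mul_assoc V.scale_left_commute del: V.scale_scale)
  finally have 1: "?E = ant H (mul H x y)" .
  \<comment> \<open>The antipode axiom at the product \<open>mul H x y\<close>, with a spectator
    factor \<open>c\<close> on the right.\<close>
  have 2: "cosum ?s H x (\<lambda>a x'.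
    cosum ?s H y (\<lambda>b y'. mul H (ant H (mul H a b)) (mul H x' (mul H y' c))))
     = scl H (cou H x * cou H y) c" for x y c
    using cosum_ant(1)[of ?s "\<lambda>z. mul H z c" "mul H x y"] by (simp add: cosum_mul mul_assoc)
  have "?E = cosum ?s H x (\<lambda>x1 x'. cosum ?s H x' (\<lambda>x2 x3. cosum ?s H y (\<lambda>y1 y'.
    cosum ?s H y' (\<lambda>y2 y3.
     mul H (ant H (mul H x1 y1)) (mul H x2 (mul H y2 (mul H (ant H y3) (ant H x3))))))))"
    by (subst (2) cosum_swap) simp_all
  also have "\<dots> =
    cosum ?s H x (\<lambda>x' x3. cosum ?s H x' (\<lambda>x1 x2. cosum ?s H y (\<lambda>y' y3. cosum ?s H y' (\<lambda>y1 y2.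
     mul H (ant H (mul H x1 y1)) (mul H x2 (mul H y2 (mul H (ant H y3) (ant H x3))))))))"
    by (simp add: cosum_coassoc)
  also have "\<dots> =
    cosum ?s H x (\<lambda>x' x3. cosum ?s H y (\<lambda>y' y3.  cosum ?s H x' (\<lambda>x1 x2. cosum ?s H y' (\<lambda>y1 y2.
     mul H (ant H (mul H x1 y1)) (mul H x2 (mul H y2 (mul H (ant H y3) (ant H x3))))))))"
    by (subst (2) cosum_swap) simp_all
  also have "\<dots> = mul H (ant H y) (ant H x)"
    using cosum_counit(1)[of ?s "\<lambda>y. mul H (ant H y) _"]
      cosum_counit(1)[of ?s "\<lambda>x. mul H _ (ant H x)"]
    by (simp add: 2 flip: V.scale_scale)
  finally show ?thesis using 1 by simp
qed

text \<open>The coproduct of S(x) and the reversed tensor S(x_2) (x) S(x_1) are both convolution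
  inverses of the coproduct. The sum \<open>?E\<close> multiplies the first, the coproduct and the
  second, and is collapsed from either end.\<close>

lemma cosum_ant_arg:
  assumes F: "\<And>a. lin (scl H) s (\<lambda>b. F a b)" "\<And>b. lin (scl H) s (\<lambda>a. F a b)"
  shows "cosum s H (ant H x) (\<lambda>a b. F a b) = cosum s H x (\<lambda>x1 x2. F (ant H x2) (ant H x1))"
proof -
  have [simp]: "vector_space s" using F(1) by (rule lin_vsD)
  note [simp] = lin_comp[OF F(1)] lin_comp[OF F(2)]
  let ?E = "cosum s H x (\<lambda>x1 x'. cosum s H x' (\<lambda>y z. cosum s H (ant H x1) (\<lambda>u v.
    cosum s H y (\<lambda>x2 x3. cosum s H z (\<lambda>x4 x5.
     F (mul H u (mul H x2 (ant H x5))) (mul H v (mul H x3 (ant H x4))))))))"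
  have "?E = cosum s H x (\<lambda>x1 x'. cosum s H x' (\<lambda>y z. cosum s H (mul H (ant H x1) y) (\<lambda>u v.
    cosum s H z (\<lambda>x4 x5.
     F (mul H u (ant H x5)) (mul H v (ant H x4))))))"
    by (simp add: cosum_mul mul_assoc)
  also have "\<dots> =
    cosum s H (one H) (\<lambda>u v. cosum s H x (\<lambda>x4 x5. F (mul H u (ant H x5)) (mul H v (ant H x4))))"
    by (rule cosum2_ant) simp_all
  also have "\<dots> = cosum s H x (\<lambda>x1 x2. F (ant H x2) (ant H x1))"
    by (simp add: cosum_one)
  finally have 1: "?E = cosum s H x (\<lambda>x1 x2. F (ant H x2) (ant H x1))" .
  \<comment> \<open>The inner pair x_3 S(x_4) cancels first; only then do x_2 and S(x_5) come from
    adjacent legs.\<close>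
  have 2: "cosum s H x (\<lambda>y z. cosum s H y (\<lambda>x2 x3. cosum s H z (\<lambda>x4 x5.
     F (mul H u (mul H x2 (ant H x5))) (mul H v (mul H x3 (ant H x4)))))) = s (cou H x) (F u v)"
    (is "?L = _") for x u v
  proof -
    have "?L = cosum s H x (\<lambda>x2 y. cosum s H y (\<lambda>x3 z. cosum s H z (\<lambda>x4 x5.
     F (mul H u (mul H x2 (ant H x5))) (mul H v (mul H x3 (ant H x4))))))"
      by (simp add: cosum_coassoc)
    also have "\<dots> = cosum s H x (\<lambda>x2 z. F (mul H u (mul H x2 (ant H z))) v)"
      using cosum2_ant(2)[of s "\<lambda>p q. F (mul H u (mul H _ (ant H q))) (mul H v p)"] by simp
    also have "\<dots> = s (cou H x) (F u v)"
      using cosum_ant(2)[of s "\<lambda>p. F (mul H u p) v"] by simp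
    finally show ?thesis .
  qed
  have "?E = cosum s H x (\<lambda>x1 x'. cosum s H (ant H x1) (\<lambda>u v. cosum s H x' (\<lambda>y z.
    cosum s H y (\<lambda>x2 x3. cosum s H z (\<lambda>x4 x5.
     F (mul H u (mul H x2 (ant H x5))) (mul H v (mul H x3 (ant H x4))))))))"
    by (rule arg_cong[where f = "cosum s H x"], intro ext,
        simp add: cosum_swap[of s H _ H "ant H _"])
  also have "\<dots> = cosum s H x (\<lambda>x1 x'. cosum s H (ant H x1) (\<lambda>u v. s (cou H x') (F u v)))"
    by (simp add: 2)
  also have "\<dots> = cosum s H (ant H x) F"
    using cosum_counit(2)[of s "\<lambda>x1. cosum s H (ant H x1) F"] by (simp add: cosum_scale)
  finally show ?thesis using 1 by simp
qed

end

section \<open>Hopf algebra maps\<close>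

locale hopf_hom = A: hopf_alg A + B: hopf_alg B
  for A :: "('k::field, 'a::ab_group_add) hopf_data"
    and B :: "('k, 'b::ab_group_add) hopf_data" +
  fixes f :: "'a \<Rightarrow> 'b"
  assumes coalgebra_hom: "coalgebra_hom A B f"
    and hom_mul: "f (mul A a b) = mul B (f a) (f b)"
    and hom_one: "f (one A) = one B"
begin

lemma lin_hom: "lin s (scl A) g \<Longrightarrow> lin s (scl B) (\<lambda>x. f (g x))"
  using coalgebra_hom by (auto simp: coalgebra_hom_def intro: lin_comp)

lemma hom_scale: "f (scl A c x) = scl B c (f x)"
  by (rule lin_scaleD[OF lin_hom]) simp

lemma cou_hom: "cou B (f a) = cou A a"
  using coalgebra_hom by (simp add: coalgebra_hom_def)

lemmas cosum_hom = coalgebra_hom_cosum[OF coalgebra_hom]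

text \<open>In the convolution algebra of maps from \<open>A\<close> to \<open>B\<close>, the map f
  S_A is a left inverse of \<open>f\<close> and S_B f is a right inverse, hence they agree.
  \<open>?E\<close> is the triple product.\<close>

lemma hom_ant: "f (ant A x) = ant B (f x)"
proof -
  note [simp] = lin_hom
  let ?s = "scl B"
  let ?E = "cosum ?s A x (\<lambda>x1 y.
    cosum ?s A y (\<lambda>x2 x3. mul B (f (ant A x1)) (mul B (f x2) (ant B (f x3)))))"
  have "?E = ant B (f x)"
    using A.cosum2_ant(1)[of ?s "\<lambda>p q. mul B (f p) (ant B (f q))"]
    by (simp add: hom_mul hom_one B.mul_assoc)
  moreover have "cosum ?s A y (\<lambda>a b. mul B c (mul B (f a) (ant B (f b)))) =
    scl B (cou A y) c" for c y
    using B.cosum_ant(2)[of ?s "mul B c" "f y"] B.lin_mul(2)[OF lin_id[OF B.vs]]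
    by (simp add: cosum_hom cou_hom)
  then have "?E = f (ant A x)"
    using A.cosum_counit(2)[of ?s "\<lambda>a. f (ant A a)"] by simp
  ultimately show ?thesis by simp
qed

end

text \<open>Serves later as psi when the target is \<open>H\<close>, and as theta when the target is
  L_[pi].\<close>

lemma (in hopf_alg) hopf_hom_id: "hopf_hom H H (\<lambda>x. x)"
proof unfold_locales
  have "cop H x = tens2 (scl H) (scl H) (sw (cop H x) (\<lambda>(x1, x2). pure (x1, x2)))" for x
    by (rule cop_eqI) (simp add: fextend_sw_cosum fextend_pure)
  then show "coalgebra_hom H H (\<lambda>x. x)"
    by (simp add: coalgebra_hom_def lin_id)
qed simp_all

section \<open>The Hopf algebra of a relative Rota-Baxter operator\<close>

locale rota_baxter = H: hopf_alg H
  for H :: "('k::field, 'h::ab_group_add) hopf_data"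
    and L :: "('k, 'l::ab_group_add) hopf_data"
    and act :: "'h \<Rightarrow> 'l \<Rightarrow> 'l"
    and \<pi> :: "'l \<Rightarrow> 'h" +
  assumes rrb: "rel_rota_baxter H L act \<pi>"
begin

section \<open>The braided structure of L as rules for Sweedler sums\<close>

lemma yd_hopf_L: "yd_hopf H L act (coad H L \<pi>)"
  using rrb by (simp add: rel_rota_baxter_def)

sublocale L: antipode_alg L
  using yd_hopf_L by unfold_locales (simp_all add: yd_hopf_def Let_def)

lemma left_module_act: "left_module H (scl L) act"
  using yd_hopf_L by (simp add: yd_hopf_def Let_def yd_module_def)

lemma lin_act [simp]:
  "lin s (scl H) g \<Longrightarrow> lin s (scl L) (\<lambda>x. act (g x) a)"
  "lin s (scl L) f \<Longrightarrow> lin s (scl L) (\<lambda>x. act y (f x))"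
  using left_module_act by (auto simp: left_module_def bilin_def intro: lin_comp)

lemma one_act [simp]: "act (one H) a = a" and mul_act: "act (mul H x y) a = act x (act y a)"
  using left_module_act by (simp_all add: left_module_def)

lemma act_mul: "act x (mul L a b) = cosum (scl L) H x (\<lambda>x1 x2. mul L (act x1 a) (act x2 b))"
  using yd_hopf_L by (simp add: yd_hopf_def Let_def yd_morphism_from_tensor_def cosum_def)

lemma act_one [simp]: "act x (one L) = scl L (cou H x) (one L)"
proof -
  interpret V: vector_space "scl L" by simp
  have "yd_morphism H (yd_unit H) \<lparr> ysc = scl L, yact = act, yco = coad H L \<pi> \<rparr>
    (\<lambda>c. scl L c (one L))"
    using yd_hopf_L by (simp only: yd_hopf_def Let_def)
  then have "\<forall>x m. scl L (cou H x * m) (one L) = act x (scl L m (one L))"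
    by (simp add: yd_morphism_def yd_unit_def)
  from this[rule_format, of x 1] show ?thesis by simp
qed

lemma cou_act [simp]: "cou L (act x a) = cou H x * cou L a"
  using yd_hopf_L by (simp add: yd_hopf_def Let_def yd_morphism_def yd_unit_def)

lemma cosum_act:
  assumes F: "\<And>a. lin (scl L) s (\<lambda>b. F a b)" "\<And>b. lin (scl L) s (\<lambda>a. F a b)"
  shows "cosum s L (act x a) (\<lambda>a b. F a b) =
    cosum s H x (\<lambda>x1 x2. cosum s L a (\<lambda>a1 a2. F (act x1 a1) (act x2 a2)))"
proof -
  have bl: "bilin (scl L) (scl L) s F" using F by (simp add: bilin_def)
  have vs: "vector_space s" using F(1) by (rule lin_vsD)
  have "cop L (act x a) = tens2 (scl L) (scl L)
        (sw (cop H x) (\<lambda>(x1, x2). sw (cop L a) (\<lambda>(m, n). pure (act x1 m, act x2 n))))"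
    using yd_hopf_L by (simp add: yd_hopf_def Let_def yd_morphism_to_tensor_def)
  then show ?thesis
    by (simp add: cosum_def[of s L "act x a"] sweedler_tens2[OF bl] fextend_sw_cosum[OF vs]
        fextend_pure[OF vs])
qed

lemma coalgebra_hom_pi: "coalgebra_hom L H \<pi>"
  using rrb by (simp add: rel_rota_baxter_def)

lemma lin_pi [simp]: "lin s (scl L) g \<Longrightarrow> lin s (scl H) (\<lambda>x. \<pi> (g x))"
  using coalgebra_hom_pi by (auto simp: coalgebra_hom_def intro: lin_comp)

lemma cou_pi [simp]: "cou H (\<pi> a) = cou L a"
  using coalgebra_hom_pi by (simp add: coalgebra_hom_def)

lemmas cosum_pi = coalgebra_hom_cosum[OF coalgebra_hom_pi]

lemma sweedler_coad:
  assumes F: "\<And>a. lin (scl L) s (\<lambda>b. F a b)" "\<And>b. lin (scl H) s (\<lambda>a. F a b)"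
  shows "sweedler s (coad H L \<pi> a) (\<lambda>(h, b). F h b) =
    cosum s L a (\<lambda>a1 b. cosum s L b (\<lambda>a2 a3. F (mul H (\<pi> a1) (ant H (\<pi> a3))) a2))"
proof -
  have bl: "bilin (scl H) (scl L) s F" using F by (simp add: bilin_def)
  have vs: "vector_space s" using F(1) by (rule lin_vsD)
  show ?thesis
    by (simp add: coad_def sweedler_tens2[OF bl] fextend_sw_cosum[OF vs] fextend_pure[OF vs])
qed

text \<open>The braided coproduct rule with the braiding computed from \<open>coad\<close>: the
  outer legs of the middle part of \<open>a\<close> act on b_1 through pi(a_2) S(pi(a_4)), and a_3
  passes to the right.\<close>

lemma cosum_mul_L:
  assumes F: "\<And>a. lin (scl L) s (\<lambda>b. F a b)" "\<And>b. lin (scl L) s (\<lambda>a. F a b)"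
  shows "cosum s L (mul L a b) (\<lambda>a b. F a b) =
    cosum s L a (\<lambda>a1 y. cosum s L y (\<lambda>a2 z. cosum s L z (\<lambda>a3 a4. cosum s L b (\<lambda>b1 b2.
      F (mul L a1 (act (mul H (\<pi> a2) (ant H (\<pi> a4))) b1)) (mul L a3 b2)))))"
proof -
  have bl: "bilin (scl L) (scl L) s F" using F by (simp add: bilin_def)
  have vs [simp]: "vector_space s" using F(1) by (rule lin_vsD)
  note [simp] = lin_comp[OF F(1)] lin_comp[OF F(2)]
  have "cop L (mul L a b) = tens2 (scl L) (scl L)
        (sw (cop L a) (\<lambda>(a1, a2). sw (coad H L \<pi> a2) (\<lambda>(h, a20). sw (cop L b) (\<lambda>(b1, b2).
           pure (mul L a1 (act h b1), mul L a20 b2)))))"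
    using yd_hopf_L unfolding yd_hopf_def Let_def by blast
  then have "cosum s L (mul L a b) (\<lambda>a b. F a b) =
    cosum s L a (\<lambda>a1 a2. sweedler s (coad H L \<pi> a2) (\<lambda>(h, a20). cosum s L b (\<lambda>b1 b2.
      F (mul L a1 (act h b1)) (mul L a20 b2))))"
    by (simp add: cosum_def sweedler_tens2[OF bl]
        fextend_sw_pair[OF vs] fextend_pure[OF vs])
  then show ?thesis by (simp add: sweedler_coad)
qed

text \<open>The coaction of \<open>act x a\<close> computed twice: directly, because the action
  respects coproducts, and by the Yetter-Drinfeld condition.\<close>

lemma cosum_yd:
  assumes F: "\<And>a. lin (scl L) s (\<lambda>b. F a b)" "\<And>b. lin (scl H) s (\<lambda>a. F a b)"
  shows "cosum s H x (\<lambda>x1 y. cosum s H y (\<lambda>x2 x3. cosum s L a (\<lambda>a1 b. cosum s L b (\<lambda>a2 a3.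
      F (mul H (\<pi> (act x1 a1)) (ant H (\<pi> (act x3 a3)))) (act x2 a2))))) =
    cosum s H x (\<lambda>x1 y. cosum s H y (\<lambda>x2 x3. cosum s L a (\<lambda>a1 b. cosum s L b (\<lambda>a2 a3.
      F (mul H (mul H x1 (mul H (\<pi> a1) (ant H (\<pi> a3)))) (ant H x3)) (act x2 a2)))))"
    (is "?L = ?R")
proof -
  have bl: "bilin (scl H) (scl L) s F" using F by (simp add: bilin_def)
  have vs [simp]: "vector_space s" using F(1) by (rule lin_vsD)
  note [simp] = lin_comp[OF F(1)] lin_comp[OF F(2)]
  have "coad H L \<pi> (act x a) = tens2 (scl H) (scl L)
        (sw (cop H x) (\<lambda>(x1, y). sw (cop H y) (\<lambda>(x2, x3). sw (coad H L \<pi> a) (\<lambda>(h, m0).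
           pure (mul H (mul H x1 h) (ant H x3), act x2 m0)))))"
    using yd_hopf_L by (simp add: yd_hopf_def Let_def yd_module_def)
  then have "sweedler s (coad H L \<pi> (act x a)) (\<lambda>(h, b). F h b) =
    cosum s H x (\<lambda>x1 y. cosum s H y (\<lambda>x2 x3. sweedler s (coad H L \<pi> a) (\<lambda>(h, m0).
      F (mul H (mul H x1 h) (ant H x3)) (act x2 m0))))"
    by (simp add: cosum_def sweedler_tens2[OF bl]
        fextend_sw_pair[OF vs] fextend_pure[OF vs])
  also have "\<dots> = ?R" by (simp add: sweedler_coad)
  finally have 1: "sweedler s (coad H L \<pi> (act x a)) (\<lambda>(h, b). F h b) = ?R" .
  have "sweedler s (coad H L \<pi> (act x a)) (\<lambda>(h, b). F h b) =
    cosum s H x (\<lambda>x1 y. cosum s L a (\<lambda>a1 b. cosum s H y (\<lambda>x2 x3. cosum s L b (\<lambda>a2 a3.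
      F (mul H (\<pi> (act x1 a1)) (ant H (\<pi> (act x3 a3)))) (act x2 a2)))))"
    by (simp add: sweedler_coad cosum_act)
  also have "\<dots> = ?L" by (simp add: cosum_swap[of s L _ H])
  finally show ?thesis using 1 by simp
qed

section \<open>The circle product as an algebra and coalgebra structure\<close>

abbreviation circ_infix (infixl "\<circ>\<^sub>\<pi>" 70) where "a \<circ>\<^sub>\<pi> b \<equiv> circ L act \<pi> a b"

lemma circ_eq: "a \<circ>\<^sub>\<pi> b = cosum (scl L) L a (\<lambda>a1 a2. mul L a1 (act (\<pi> a2) b))"
  by (simp add: circ_def cosum_def)

lemma pi_circ: "\<pi> (a \<circ>\<^sub>\<pi> b) = mul H (\<pi> a) (\<pi> b)"
  using rrb by (simp add: rel_rota_baxter_def circ_def)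

lemma lin_circ [simp]:
  "lin s (scl L) g \<Longrightarrow> lin s (scl L) (\<lambda>x. g x \<circ>\<^sub>\<pi> b)"
  "lin s (scl L) g \<Longrightarrow> lin s (scl L) (\<lambda>x. b \<circ>\<^sub>\<pi> g x)"
  unfolding circ_eq by (simp_all add: lin_vsD)

lemma lin_circ_apply:
  assumes "lin (scl L) s h"
  shows "h (a \<circ>\<^sub>\<pi> b) = cosum s L a (\<lambda>a1 a2. h (mul L a1 (act (\<pi> a2) b)))"
  unfolding circ_eq by (rule lin_cosum[OF assms])

lemma cou_circ: "cou L (a \<circ>\<^sub>\<pi> b) = cou L a * cou L b"
proof -
  have m: "cou L (mul L a b) = cou L a * cou L b" for a b
    using yd_hopf_L by (simp add: yd_hopf_def Let_def)
  show ?thesis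
    by (subst lin_circ_apply[OF L.lin_cou]) (simp add: m mult.left_commute)
qed

text \<open>Antipode cancellation in \<open>H\<close> for two legs of a coproduct in
  \<open>L\<close>; only the fact that \<open>\<pi>\<close> is a coalgebra map enters.\<close>

lemma cosum2_ant_pi:
  assumes G: "\<And>a. lin (scl L) s (\<lambda>b. G a b)" "\<And>b. lin (scl H) s (\<lambda>a. G a b)"
  shows "cosum s L x (\<lambda>a y. cosum s L y (\<lambda>b c. G (mul H (ant H (\<pi> a)) (\<pi> b)) c)) = G (one H) x"
    and "cosum s L x (\<lambda>a y. cosum s L y (\<lambda>b c. G (mul H (\<pi> a) (ant H (\<pi> b))) c)) = G (one H) x"
proof -
  have [simp]: "vector_space s" using G(1) by (rule lin_vsD)
  note [simp] = lin_comp[OF G(1)] lin_comp[OF G(2)]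
  have *: "cosum s L y (\<lambda>a b. G (mul H (ant H (\<pi> a)) (\<pi> b)) c) = s (cou L y) (G (one H) c)"
    "cosum s L y (\<lambda>a b. G (mul H (\<pi> a) (ant H (\<pi> b))) c) = s (cou L y) (G (one H) c)" for y c
    using H.cosum_ant[OF G(2), of "\<pi> y"] by (simp_all add: cosum_pi)
  note ** = L.cosum_counit(1)[OF G(1)]
  show "cosum s L x (\<lambda>a y. cosum s L y (\<lambda>b c. G (mul H (ant H (\<pi> a)) (\<pi> b)) c)) = G (one H) x"
    by (subst L.cosum_coassoc[symmetric]) (simp_all add: * **)
  show "cosum s L x (\<lambda>a y. cosum s L y (\<lambda>b c. G (mul H (\<pi> a) (ant H (\<pi> b))) c)) = G (one H) x"
    by (subst L.cosum_coassoc[symmetric]) (simp_all add: * **)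
qed

text \<open>The braiding brings in S(pi(a_4)), and the coproduct of pi(a) in the second factor
  brings in pi(a_5) right next to it. Their cancellation turns the braided coproduct rule into the
  ordinary one.\<close>

lemma cosum_circ:
  assumes F: "\<And>a. lin (scl L) s (\<lambda>b. F a b)" "\<And>b. lin (scl L) s (\<lambda>a. F a b)"
  shows "cosum s L (a \<circ>\<^sub>\<pi> b) (\<lambda>a b. F a b) =
    cosum s L a (\<lambda>a1 a2. cosum s L b (\<lambda>b1 b2. F (a1 \<circ>\<^sub>\<pi> b1) (a2 \<circ>\<^sub>\<pi> b2)))"
proof -
  have vs [simp]: "vector_space s" using F(1) by (rule lin_vsD)
  note [simp] = lin_comp[OF F(1)] lin_comp[OF F(2)]
  have "cosum s L (a \<circ>\<^sub>\<pi> b) F = cosum s L a (\<lambda>a' y. cosum s L (mul L a' (act (\<pi> y) b)) F)"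
    by (rule lin_circ_apply) (simp add: F)
  also have "\<dots> =
    cosum s L a (\<lambda>a1 y. cosum s L y (\<lambda>a2 y. cosum s L y (\<lambda>a3 y. cosum s L y (\<lambda>a4 y.
    cosum s L y (\<lambda>a5 a6. cosum s L b (\<lambda>b1 b2.
     F (mul L a1 (act (\<pi> a2) (act (mul H (ant H (\<pi> a4)) (\<pi> a5)) b1))) (mul L a3 (act (\<pi> a6) b2))))))))"
    by (simp add: cosum_mul_L cosum_act cosum_pi L.cosum_coassoc L.cosum_gather mul_act)
  also have "\<dots> = cosum s L a (\<lambda>a1 y. cosum s L y (\<lambda>a2 y. cosum s L y (\<lambda>a3 a6. cosum s L b (\<lambda>b1 b2.
     F (mul L a1 (act (\<pi> a2) b1)) (mul L a3 (act (\<pi> a6) b2))))))"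
    by (subst cosum2_ant_pi(1)[of s "\<lambda>u a6. cosum s L b (\<lambda>b1 b2.
      F (mul L _ (act (\<pi> _) (act u b1))) (mul L _ (act (\<pi> a6) b2)))"]) simp_all
  also have "\<dots> = cosum s L a (\<lambda>a1 a2. cosum s L b (\<lambda>b1 b2. F (a1 \<circ>\<^sub>\<pi> b1) (a2 \<circ>\<^sub>\<pi> b2)))"
    using lin_circ_apply[OF F(1)] lin_circ_apply[OF F(2)]
    by (simp add: L.cosum_coassoc L.cosum_gather)
  finally show ?thesis by simp
qed

lemma cosum_ant_pi:
  assumes h: "lin (scl H) s h"
  shows "cosum s L x (\<lambda>a b. h (mul H (ant H (\<pi> a)) (\<pi> b))) = s (cou L x) (h (one H))"
proof -
  note [simp] = lin_comp[OF h]
  show ?thesis using H.cosum_ant(1)[OF h, of "\<pi> x"] lin_vsD(2)[OF h] by (simp add: cosum_pi)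
qed

lemma cou_one_L [simp]: "cou L (one L) = 1"
  using yd_hopf_L by (simp add: yd_hopf_def Let_def)

lemma cosum_one_L:
  assumes F: "\<And>a. lin (scl L) s (\<lambda>b. F a b)" "\<And>b. lin (scl L) s (\<lambda>a. F a b)"
  shows "cosum s L (one L) (\<lambda>a b. F a b) = F (one L) (one L)"
proof -
  have bl: "bilin (scl L) (scl L) s F" using F by (simp add: bilin_def)
  have vs: "vector_space s" using F(1) by (rule lin_vsD)
  have "cop L (one L) = tens2 (scl L) (scl L) (pure (one L, one L))"
    using yd_hopf_L by (simp add: yd_hopf_def Let_def)
  then show ?thesis
    by (simp add: cosum_def[of s L "one L"] sweedler_tens2[OF bl] fextend_pure[OF vs])
qed

text \<open>The element pi(1) is grouplike, hence inverted on the left by its antipode, and the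
  Rota-Baxter identity at (1, 1) makes it idempotent. Such an element is 1.\<close>

lemma pi_one: "\<pi> (one L) = one H"
proof -
  interpret VH: vector_space "scl H" by simp
  interpret VL: vector_space "scl L" by simp
  have "cosum (scl H) H (\<pi> (one L)) (\<lambda>a b. mul H (ant H a) b) =
    mul H (ant H (\<pi> (one L))) (\<pi> (one L))"
    by (simp add: cosum_pi cosum_one_L)
  with H.cosum_ant(1)[of "scl H" "\<lambda>x. x" "\<pi> (one L)"]
  have inv: "mul H (ant H (\<pi> (one L))) (\<pi> (one L)) = one H" by simp
  have "one L \<circ>\<^sub>\<pi> one L = one L" by (simp add: circ_eq cosum_one_L)
  then have idem: "mul H (\<pi> (one L)) (\<pi> (one L)) = \<pi> (one L)" by (simp flip: pi_circ)
  have "\<pi> (one L) = mul H (mul H (ant H (\<pi> (one L))) (\<pi> (one L))) (\<pi> (one L))"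
    by (simp add: inv)
  also have "\<dots> = mul H (ant H (\<pi> (one L))) (mul H (\<pi> (one L)) (\<pi> (one L)))"
    by (rule H.mul_assoc)
  also have "\<dots> = one H" by (simp only: idem inv)
  finally show ?thesis .
qed

lemma act_cosum: "act x (cosum (scl L) C y F) = cosum (scl L) C y (\<lambda>u v. act x (F u v))"
  by (rule lin_cosum) simp

lemma one_circ: "one L \<circ>\<^sub>\<pi> a = a"
  by (simp add: circ_eq cosum_one_L pi_one)

lemma circ_one: "a \<circ>\<^sub>\<pi> one L = a"
  by (simp add: circ_eq)

text \<open>Since coproducts respect the circle product and \<open>\<pi>\<close> turns it into the
  product of \<open>H\<close>, both sides expand to a_1 (pi(a_2) . b_1) (pi(a_3) pi(b_2) . c); on
  the right this uses that \<open>act\<close> distributes over products.\<close>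

lemma circ_assoc: "(a \<circ>\<^sub>\<pi> b) \<circ>\<^sub>\<pi> c = a \<circ>\<^sub>\<pi> (b \<circ>\<^sub>\<pi> c)"
proof -
  let ?s = "scl L"
  have "(a \<circ>\<^sub>\<pi> b) \<circ>\<^sub>\<pi> c = cosum ?s L a (\<lambda>a1 a2. cosum ?s L b (\<lambda>b1 b2.
      mul L (a1 \<circ>\<^sub>\<pi> b1) (act (mul H (\<pi> a2) (\<pi> b2)) c)))"
    by (subst circ_eq) (simp add: cosum_circ pi_circ)
  also have "\<dots> = cosum ?s L a (\<lambda>a1 y. cosum ?s L y (\<lambda>a2 a3. cosum ?s L b (\<lambda>b1 b2.
      mul L a1 (mul L (act (\<pi> a2) b1) (act (\<pi> a3) (act (\<pi> b2) c))))))"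
    by (simp add: circ_eq L.mul_cosum mul_act L.mul_assoc
        L.cosum_coassoc L.cosum_gather)
  also have "\<dots> = a \<circ>\<^sub>\<pi> (b \<circ>\<^sub>\<pi> c)"
    by (simp add: circ_eq L.mul_cosum act_cosum act_mul cosum_pi L.mul_assoc L.cosum_coassoc L.cosum_gather
        cosum_swap[of _ L b L])
  finally show ?thesis .
qed

section \<open>The antipode of L_[pi]\<close>

abbreviation T where "T \<equiv> T_pi H L act \<pi>"

lemma T_eq: "T a = cosum (scl L) L a (\<lambda>a1 a2. act (ant H (\<pi> a1)) (ant L a2))"
  by (simp add: T_pi_def cosum_def)

lemma lin_T [simp]: "lin s (scl L) g \<Longrightarrow> lin s (scl L) (\<lambda>x. T (g x))"
  unfolding T_eq by simp

text \<open>The right inverse law: pi(a_2) S_H(pi(a_3)) cancels in the middle, and the antipode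
  axiom of \<open>L\<close> remains.\<close>

lemma circ_T: "cosum (scl L) L a (\<lambda>a1 a2. a1 \<circ>\<^sub>\<pi> T a2) = scl L (cou L a) (one L)"
proof -
  let ?s = "scl L"
  have "cosum ?s L a (\<lambda>a1 a2. a1 \<circ>\<^sub>\<pi> T a2) =
    cosum ?s L a (\<lambda>a1 y. cosum ?s L y (\<lambda>a2 y. cosum ?s L y (\<lambda>a3 a4.
      mul L a1 (act (mul H (\<pi> a2) (ant H (\<pi> a3))) (ant L a4)))))"
    by (simp add: circ_eq T_eq L.mul_cosum act_cosum mul_act L.cosum_coassoc L.cosum_gather)
  also have "\<dots> = cosum ?s L a (\<lambda>a1 a2. mul L a1 (ant L a2))"
    by (subst cosum2_ant_pi(2)[of ?s "\<lambda>u v. mul L _ (act u (ant L v))"]) simp_all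
  also have "\<dots> = scl L (cou L a) (one L)"
    using L.cosum_ant(2)[of ?s "\<lambda>x. x" a] by simp
  finally show ?thesis .
qed

text \<open>
  \<open>a \<otimes> b \<mapsto> a\<^sub>1 \<otimes> U a\<^sub>2 b\<close> inverts the Galois map \<open>a \<otimes> b \<mapsto> a\<^sub>1 \<otimes> a\<^sub>2 \<circ>\<^sub>\<pi> b\<close>, which is a composition of
  two maps inverted by means of \<open>S\<^sub>H\<close> and \<open>S\<^sub>L\<close>.
\<close>

definition U where "U a b = cosum (scl L) L a (\<lambda>a1 a2. act (ant H (\<pi> a1)) (mul L (ant L a2) b))"

lemma lin_U [simp]:
  "lin s (scl L) g \<Longrightarrow> lin s (scl L) (\<lambda>x. U (g x) b)"
  "lin s (scl L) g \<Longrightarrow> lin s (scl L) (\<lambda>x. U b (g x))"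
  unfolding U_def by (simp_all add: lin_vsD)

text \<open>First S_L(a_2) a_3 cancels, which brings S_H(pi(a_1)) next to the remaining
  pi(a_4).\<close>

lemma U_circ: "cosum (scl L) L a (\<lambda>a1 a2. U a1 (a2 \<circ>\<^sub>\<pi> b)) = scl L (cou L a) b"
proof -
  let ?s = "scl L"
  have "cosum ?s L a (\<lambda>a1 a2. U a1 (a2 \<circ>\<^sub>\<pi> b)) =
    cosum ?s L a (\<lambda>a1 y. cosum ?s L y (\<lambda>a2 y. cosum ?s L y (\<lambda>a3 a4.
      act (ant H (\<pi> a1)) (mul L (mul L (ant L a2) a3) (act (\<pi> a4) b)))))"
    by (simp add: circ_eq U_def L.mul_cosum act_cosum mul_act L.cosum_coassoc L.cosum_gather L.mul_assoc)
  also have "\<dots> = cosum ?s L a (\<lambda>a1 a2. act (mul H (ant H (\<pi> a1)) (\<pi> a2)) b)"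
    by (subst L.cosum2_ant(1)[of ?s "\<lambda>u v. act (ant H (\<pi> _)) (mul L u (act (\<pi> v) b))"])
      (simp_all add: mul_act)
  also have "\<dots> = scl L (cou L a) b"
    using cosum_ant_pi[of ?s "\<lambda>x. act x b" a] by simp
  finally show ?thesis .
qed

text \<open>By \<open>circ_T\<close> and associativity, b may be replaced by a_2 o (T(a_3) o b)
  inside U(a_1, b). After regrouping the legs, \<open>U_circ\<close> removes a_1 and a_2.\<close>

lemma U_eq: "U a b = T a \<circ>\<^sub>\<pi> b"
proof -
  let ?s = "scl L"
  have 1: "cosum ?s L y (\<lambda>a2 a3. U c (a2 \<circ>\<^sub>\<pi> (T a3 \<circ>\<^sub>\<pi> b))) = scl L (cou L y) (U c b)" for y c
  proof -
    have "cosum ?s L y (\<lambda>a2 a3. U c (a2 \<circ>\<^sub>\<pi> (T a3 \<circ>\<^sub>\<pi> b))) =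
      U c (cosum ?s L y (\<lambda>a2 a3. a2 \<circ>\<^sub>\<pi> T a3) \<circ>\<^sub>\<pi> b)"
      by (subst lin_cosum[of ?s ?s "\<lambda>z. U c (z \<circ>\<^sub>\<pi> b)"]) (simp_all add: circ_assoc)
    also have "\<dots> = scl L (cou L y) (U c b)"
      by (simp add: circ_T one_circ lin_scaleD[of ?s ?s "\<lambda>z. U c (z \<circ>\<^sub>\<pi> b)"])
    finally show ?thesis .
  qed
  have "U a b = cosum ?s L a (\<lambda>a1 y. cosum ?s L y (\<lambda>a2 a3. U a1 (a2 \<circ>\<^sub>\<pi> (T a3 \<circ>\<^sub>\<pi> b))))"
    by (simp add: 1)
  also have "\<dots> = cosum ?s L a (\<lambda>y a3. cosum ?s L y (\<lambda>a1 a2. U a1 (a2 \<circ>\<^sub>\<pi> (T a3 \<circ>\<^sub>\<pi> b))))"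
    by (simp add: L.cosum_coassoc)
  also have "\<dots> = T a \<circ>\<^sub>\<pi> b"
    by (simp add: U_circ)
  finally show ?thesis .
qed

text \<open>The left inverse law. Passing through \<open>U\<close> puts S_L(a_2) and a_3 side by
  side, where the antipode axiom of \<open>L\<close> applies.\<close>

lemma T_circ: "cosum (scl L) L a (\<lambda>a1 a2. T a1 \<circ>\<^sub>\<pi> a2) = scl L (cou L a) (one L)"
proof -
  let ?s = "scl L"
  have "cosum ?s L a (\<lambda>a1 a2. T a1 \<circ>\<^sub>\<pi> a2) = cosum ?s L a (\<lambda>a1 y. cosum ?s L y (\<lambda>a2 a3.
      act (ant H (\<pi> a1)) (mul L (ant L a2) a3)))"
    by (simp add: U_eq[symmetric] U_def L.cosum_coassoc)
  also have "\<dots> = cosum ?s L a (\<lambda>a1 a2. scl L (cou L a2) (scl L (cou L a1) (one L)))"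
    using L.cosum_ant(1)[of ?s "act (ant H (\<pi> _))"] by simp
  also have "\<dots> = scl L (cou L a) (one L)"
    by (rule L.cosum_counit_simps(2)) simp
  finally show ?thesis .
qed

section \<open>The Hopf algebra L_[pi] and its map to H\<close>

abbreviation P where "P \<equiv> L_pi H L act \<pi>"

lemma P_simps:
  "scl P = scl L" "mul P = circ L act \<pi>" "one P = one L" "cop P = cop L" "cou P = cou L" "ant P = T"
  by (simp_all add: L_pi_def)

lemma cosum_P: "cosum s P = cosum s L"
  by (simp add: cosum_def P_simps fun_eq_iff)

lemma is_hopf_P: "is_hopf P"
proof -
  have "is_algebra P"
    by (simp add: is_algebra_def P_simps bilin_def circ_assoc one_circ circ_one)
  moreover have "is_coalgebra P"
    using L.coalgebra by (simp add: is_coalgebra_def P_simps)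
  moreover have "cop L (a \<circ>\<^sub>\<pi> b) = tens2 (scl L) (scl L)
        (sw (cop L a) (\<lambda>(a1, a2). sw (cop L b) (\<lambda>(b1, b2). pure (a1 \<circ>\<^sub>\<pi> b1, a2 \<circ>\<^sub>\<pi> b2))))" for a b
    by (rule L.cop_eqI) (simp add: fextend_sw_cosum fextend_pure cosum_circ bilinD)
  moreover have "cop L (one L) = tens2 (scl L) (scl L) (pure (one L, one L))"
    using yd_hopf_L by (simp add: yd_hopf_def Let_def)
  moreover have "is_antipode P"
    using T_circ circ_T by (simp add: is_antipode_def P_simps cosum_def)
  ultimately show ?thesis
    by (simp add: is_hopf_def P_simps cou_circ)
qed

sublocale P: hopf_alg P
  by unfold_locales (rule is_hopf_P)

text \<open>The Rota-Baxter identity is exactly multiplicativity of \<open>\<pi>\<close> for the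
  circle product.\<close>

sublocale pi: hopf_hom P H \<pi>
  using coalgebra_hom_pi
  by unfold_locales (simp_all add: coalgebra_hom_def P_simps pi_circ pi_one)

section \<open>The matched pair formed by H and L_[pi]\<close>

lemma pair_ant:
  assumes g [simp]: "\<And>a. lin (scl H) (scl H) (\<lambda>x. g x a)" "\<And>x. lin (scl L) (scl H) (g x)"
    and cou: "\<And>x a. cou H (g x a) = cou H x * cou L a"
    and cosum: "\<And>F x a. (\<And>a. lin (scl H) s (F a)) \<Longrightarrow> (\<And>b. lin (scl H) s (\<lambda>a. F a b)) \<Longrightarrow>
      cosum s H (g x a) F = cosum s H x (\<lambda>x1 x2. cosum s L a (\<lambda>a1 a2. F (g x1 a1) (g x2 a2)))"
    and h: "lin (scl H) s h"
  shows "cosum s H x (\<lambda>x1 x2. cosum s L a (\<lambda>a1 a2. h (mul H (ant H (g x1 a1)) (g x2 a2))))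
      = s (cou H x * cou L a) (h (one H))"
    and "cosum s H x (\<lambda>x1 x2. cosum s L a (\<lambda>a1 a2. h (mul H (g x1 a1) (ant H (g x2 a2)))))
      = s (cou H x * cou L a) (h (one H))"
proof -
  note [simp] = lin_comp[OF h]
  show "cosum s H x (\<lambda>x1 x2. cosum s L a (\<lambda>a1 a2. h (mul H (ant H (g x1 a1)) (g x2 a2))))
      = s (cou H x * cou L a) (h (one H))"
    by (subst cosum[of "\<lambda>u v. h (mul H (ant H u) v)", symmetric])
      (simp_all add: H.cosum_ant[OF h] cou)
  show "cosum s H x (\<lambda>x1 x2. cosum s L a (\<lambda>a1 a2. h (mul H (g x1 a1) (ant H (g x2 a2)))))
      = s (cou H x * cou L a) (h (one H))"
    by (subst cosum[of "\<lambda>u v. h (mul H u (ant H v))", symmetric])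
      (simp_all add: H.cosum_ant[OF h] cou)
qed

lemma cosum_pair_counit:
  assumes F: "\<And>a. lin (scl H) s (\<lambda>x. F x a)" "\<And>x. lin (scl L) s (F x)"
  shows "cosum s H x (\<lambda>x1 x2. cosum s L a (\<lambda>a1 a2. s (cou H x1 * cou L a1) (F x2 a2))) = F x a"
    and "cosum s H x (\<lambda>x1 x2. cosum s L a (\<lambda>a1 a2. s (cou H x2 * cou L a2) (F x1 a1))) = F x a"
proof -
  have vs: "vector_space s" using F(1) by (rule lin_vsD)
  interpret V: vector_space s by (rule vs)
  note [simp] = F cosum_scale[OF vs]
  show "cosum s H x (\<lambda>x1 x2. cosum s L a (\<lambda>a1 a2. s (cou H x1 * cou L a1) (F x2 a2))) = F x a"
    "cosum s H x (\<lambda>x1 x2. cosum s L a (\<lambda>a1 a2. s (cou H x2 * cou L a2) (F x1 a1))) = F x a"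
    using H.cosum_counit[OF F(1)] L.cosum_counit[OF F(2)] by (simp_all flip: V.scale_scale)
qed

abbreviation p where "p x a \<equiv> \<pi> (act x a)"
abbreviation q where "q x a \<equiv> mul H x (\<pi> a)"

lemma cosum_p:
  assumes "\<And>a. lin (scl H) s (F a)" "\<And>b. lin (scl H) s (\<lambda>a. F a b)"
  shows "cosum s H (p x a) F = cosum s H x (\<lambda>x1 x2. cosum s L a (\<lambda>a1 a2. F (p x1 a1) (p x2 a2)))"
proof -
  note [simp] = assms lin_comp[OF assms(1)] lin_comp[OF assms(2)]
  show ?thesis by (simp add: cosum_pi cosum_act)
qed

lemma cosum_q:
  assumes "\<And>a. lin (scl H) s (F a)" "\<And>b. lin (scl H) s (\<lambda>a. F a b)"
  shows "cosum s H (q x a) F = cosum s H x (\<lambda>x1 x2. cosum s L a (\<lambda>a1 a2. F (q x1 a1) (q x2 a2)))"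
proof -
  note [simp] = assms lin_comp[OF assms(1)] lin_comp[OF assms(2)]
  show ?thesis by (simp add: cosum_pi H.cosum_mul)
qed

lemma p_ant:
  assumes h: "lin (scl H) s h"
  shows "cosum s H x (\<lambda>x1 x2. cosum s L a (\<lambda>a1 a2. h (mul H (ant H (p x1 a1)) (p x2 a2))))
      = s (cou H x * cou L a) (h (one H))"
    and "cosum s H x (\<lambda>x1 x2. cosum s L a (\<lambda>a1 a2. h (mul H (p x1 a1) (ant H (p x2 a2)))))
      = s (cou H x * cou L a) (h (one H))"
  by (rule pair_ant[OF _ _ _ cosum_p h]; simp)+

lemma q_ant:
  assumes h: "lin (scl H) s h"
  shows "cosum s H x (\<lambda>x1 x2. cosum s L a (\<lambda>a1 a2. h (mul H (ant H (q x1 a1)) (q x2 a2))))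
      = s (cou H x * cou L a) (h (one H))"
  by (rule pair_ant[OF _ _ _ cosum_q h]; simp)

text \<open>The analogue of \<open>cosum2_ant\<close> for the coalgebra H (x) L: the first two legs
  cancel through \<open>p\<close>, the third is kept.\<close>

lemma p_ant_start:
  assumes F: "\<And>x a. lin (scl H) s (\<lambda>h. F h x a)" "\<And>h a. lin (scl H) s (\<lambda>x. F h x a)"
    "\<And>h x. lin (scl L) s (F h x)"
  shows "cosum s H x (\<lambda>x1 y. cosum s H y (\<lambda>x2 x3. cosum s L a (\<lambda>a1 b. cosum s L b (\<lambda>a2 a3.
      F (mul H (ant H (p x1 a1)) (p x2 a2)) x3 a3)))) = F (one H) x a" (is "?A = _")
    and "cosum s H x (\<lambda>x1 y. cosum s H y (\<lambda>x2 x3. cosum s L a (\<lambda>a1 b. cosum s L b (\<lambda>a2 a3.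
      F (mul H (p x1 a1) (ant H (p x2 a2))) x3 a3)))) = F (one H) x a" (is "?B = _")
proof -
  have vs [simp]: "vector_space s" using F(1) by (rule lin_vsD)
  note [simp] = lin_comp[OF F(1)] lin_comp[OF F(2)] lin_comp[OF F(3)]
  note sw = cosum_swap[of s L _ H, OF vs]
  have "?A = cosum s H x (\<lambda>y x3. cosum s L a (\<lambda>b a3. cosum s H y (\<lambda>x1 x2. cosum s L b (\<lambda>a1 a2.
      F (mul H (ant H (p x1 a1)) (p x2 a2)) x3 a3))))"
    by (simp add: H.cosum_coassoc L.cosum_coassoc sw)
  then show "?A = F (one H) x a" by (simp add: p_ant(1)[OF F(1)] cosum_pair_counit F)
  have "?B = cosum s H x (\<lambda>y x3. cosum s L a (\<lambda>b a3. cosum s H y (\<lambda>x1 x2. cosum s L b (\<lambda>a1 a2.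
      F (mul H (p x1 a1) (ant H (p x2 a2))) x3 a3))))"
    by (simp add: H.cosum_coassoc L.cosum_coassoc sw)
  then show "?B = F (one H) x a" by (simp add: p_ant(2)[OF F(1)] cosum_pair_counit F)
qed

text \<open>The action on \<open>H\<close>, bracketed as the convolution product of S p and
  \<open>q\<close>, so that convolving with \<open>p\<close> on the left recovers
  \<open>q\<close>.\<close>

definition r where
  "r x a = cosum (scl H) H x (\<lambda>x1 x2.
    cosum (scl H) L a (\<lambda>a1 a2. mul H (ant H (p x1 a1)) (q x2 a2)))"

lemma lin_r [simp]:
  "lin s (scl H) g \<Longrightarrow> lin s (scl H) (\<lambda>x. r (g x) b)"
  "lin s (scl L) f \<Longrightarrow> lin s (scl H) (\<lambda>x. r y (f x))"
  unfolding r_def by (simp_all add: lin_vsD)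

lemma lin_r_apply:
  assumes "lin (scl H) s h"
  shows "h (r x a) =
    cosum s H x (\<lambda>x1 x2. cosum s L a (\<lambda>a1 a2. h (mul H (ant H (p x1 a1)) (q x2 a2))))"
  unfolding r_def by (simp add: lin_cosum[OF assms])

lemma p_r:
  assumes h: "lin (scl H) s h"
  shows "cosum s H x (\<lambda>x1 x2. cosum s L a (\<lambda>a1 a2. h (mul H (p x1 a1) (r x2 a2)))) = h (q x a)"
proof -
  have vs [simp]: "vector_space s" using h by (rule lin_vsD)
  note [simp] = lin_comp[OF h]
  note sw = cosum_swap[of s L _ H, OF vs]
  have "h (mul H c (r x a)) =
    cosum s H x (\<lambda>x1 x2. cosum s L a (\<lambda>a1 a2. h (mul H c (mul H (ant H (p x1 a1)) (q x2 a2)))))"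
    for c x a
    by (rule lin_r_apply) simp
  then have "cosum s H x (\<lambda>x1 x2. cosum s L a (\<lambda>a1 a2. h (mul H (p x1 a1) (r x2 a2)))) =
    cosum s H x (\<lambda>x1 y. cosum s H y (\<lambda>x2 x3. cosum s L a (\<lambda>a1 b. cosum s L b (\<lambda>a2 a3.
      h (mul H (mul H (p x1 a1) (ant H (p x2 a2))) (q x3 a3))))))"
    by (simp add: H.mul_assoc sw)
  also have "\<dots> = h (q x a)"
    by (subst p_ant_start(2)[of s "\<lambda>u x a. h (mul H u (q x a))"]) simp_all
  finally show ?thesis .
qed

text \<open>
  The Yetter-Drinfeld condition says that \<open>p\<^sub>1 S(p\<^sub>3) \<otimes> act\<^sub>2\<close> and \<open>q\<^sub>1 S(q\<^sub>3) \<otimes> act\<^sub>2\<close> agree;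
  multiply by \<open>S(p)\<close> from the left and by \<open>q\<close> from the right.
\<close>

lemma r_act_flip:
  assumes F: "\<And>a. lin (scl L) s (\<lambda>b. F a b)" "\<And>b. lin (scl H) s (\<lambda>a. F a b)"
  shows "cosum s H x (\<lambda>x1 x2. cosum s L a (\<lambda>a1 a2. F (r x1 a1) (act x2 a2))) =
    cosum s H x (\<lambda>x1 x2. cosum s L a (\<lambda>a1 a2. F (r x2 a2) (act x1 a1)))"
proof -
  have vs [simp]: "vector_space s" using F(1) by (rule lin_vsD)
  note [simp] = lin_comp[OF F(1)] lin_comp[OF F(2)]
  note sw = cosum_swap[of s L _ H, OF vs]
  note coassoc = H.cosum_coassoc L.cosum_coassoc H.cosum_gather L.cosum_gather sw
  have "cosum s H x (\<lambda>x1 x2. cosum s L a (\<lambda>a1 a2. F (r x2 a2) (act x1 a1))) =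
     cosum s H x (\<lambda>x3 y. cosum s H y (\<lambda>x4 x5. cosum s L a (\<lambda>a3 b. cosum s L b (\<lambda>a4 a5.
      F (mul H (ant H (p x4 a4)) (q x5 a5)) (act x3 a3)))))"
    by (simp add: lin_r_apply[OF F(2)] sw)
  \<comment> \<open>A trivial factor S(p_1) p_2 is inserted in front, so that p_2 and S(p_4) enclose
    the third leg as the Yetter-Drinfeld condition requires.\<close>
  also have "\<dots> = cosum s H x (\<lambda>x1 y. cosum s H y (\<lambda>x2 y. cosum s L a (\<lambda>a1 b. cosum s L b (\<lambda>a2 b.
       cosum s H y (\<lambda>x3 y. cosum s H y (\<lambda>x4 x5. cosum s L b (\<lambda>a3 b. cosum s L b (\<lambda>a4 a5.
      F (mul H (mul H (ant H (p x1 a1)) (p x2 a2)) (mul H (ant H (p x4 a4)) (q x5 a5))) (act x3 a3)))))))))"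
    by (subst p_ant_start(1)[of s "\<lambda>u y b. cosum s H y (\<lambda>x3 y. cosum s H y (\<lambda>x4 x5.
      cosum s L b (\<lambda>a3 b. cosum s L b (\<lambda>a4 a5.
      F (mul H u (mul H (ant H (p x4 a4)) (q x5 a5))) (act x3 a3)))))"]) simp_all
  also have "\<dots> = cosum s H x (\<lambda>x1 y. cosum s H y (\<lambda>z x5. cosum s L a (\<lambda>a1 b. cosum s L b (\<lambda>c a5.
       cosum s H z (\<lambda>x2 y. cosum s H y (\<lambda>x3 x4. cosum s L c (\<lambda>a2 b. cosum s L b (\<lambda>a3 a4.
      F (mul H (ant H (p x1 a1)) (mul H (mul H (p x2 a2) (ant H (p x4 a4))) (q x5 a5))) (act x3 a3)))))))))"
    by (simp add: coassoc H.mul_assoc)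
  also have "\<dots> = cosum s H x (\<lambda>x1 y. cosum s H y (\<lambda>z x5. cosum s L a (\<lambda>a1 b. cosum s L b (\<lambda>c a5.
       cosum s H z (\<lambda>x2 y. cosum s H y (\<lambda>x3 x4. cosum s L c (\<lambda>a2 b. cosum s L b (\<lambda>a3 a4.
      F (mul H (ant H (p x1 a1)) (mul H (mul H (q x2 a2) (ant H (q x4 a4))) (q x5 a5))) (act x3 a3)))))))))"
    by (subst cosum_yd[of s "\<lambda>u v. F (mul H (ant H (p _ _)) (mul H u (q _ _))) v"])
      (simp_all add: H.ant_mul H.mul_assoc)
  also have "\<dots> =
    cosum s H x (\<lambda>x1 y. cosum s H y (\<lambda>x2 y. cosum s L a (\<lambda>a1 b. cosum s L b (\<lambda>a2 b.
    cosum s H y (\<lambda>x3 z. cosum s L b (\<lambda>a3 c.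
       cosum s H z (\<lambda>x4 x5. cosum s L c (\<lambda>a4 a5.
      F (mul H (mul H (ant H (p x1 a1)) (q x2 a2)) (mul H (ant H (q x4 a4)) (q x5 a5))) (act x3 a3)))))))))"
    by (simp add: coassoc H.mul_assoc)
  \<comment> \<open>The tail S(q_4) q_5 cancels. What stands before the action is S(p_1) q_2, the
    summand of \<open>r\<close>.\<close>
  also have "\<dots> = cosum s H x (\<lambda>x1 y. cosum s H y (\<lambda>x2 x3. cosum s L a (\<lambda>a1 b. cosum s L b (\<lambda>a2 a3.
      F (mul H (ant H (p x1 a1)) (q x2 a2)) (act x3 a3)))))"
    using q_ant[of s "\<lambda>u. F (mul H _ u) _"]
      cosum_pair_counit(2)[of s "\<lambda>x a. F (mul H _ _) (act x a)"]
    by simp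
  also have "\<dots> = cosum s H x (\<lambda>x1 x2. cosum s L a (\<lambda>a1 a2. F (r x1 a1) (act x2 a2)))"
    by (simp add: lin_r_apply[OF F(2)] coassoc)
  finally show ?thesis by simp
qed

text \<open>Expanding the circle product lets p(x_2, a_2) r(x_3, a_3) act on \<open>b\<close>. By
  \<open>p_r\<close> this is the action of q = x_2 pi(a_2), and the rule for the action on a product
  finishes.\<close>

lemma act_circ:
  "act x (a \<circ>\<^sub>\<pi> b) =
    cosum (scl L) H x (\<lambda>x1 x2. cosum (scl L) L a (\<lambda>a1 a2. act x1 a1 \<circ>\<^sub>\<pi> act (r x2 a2) b))"
proof -
  let ?s = "scl L"
  note sw = cosum_swap[of ?s L _ H, OF L.vs]
  note coassoc = H.cosum_coassoc L.cosum_coassoc H.cosum_gather L.cosum_gather sw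
  have "cosum ?s H x (\<lambda>x1 x2. cosum ?s L a (\<lambda>a1 a2. act x1 a1 \<circ>\<^sub>\<pi> act (r x2 a2) b)) =
    cosum ?s H x (\<lambda>x1 z. cosum ?s L a (\<lambda>a1 c. cosum ?s H z (\<lambda>x2 x3. cosum ?s L c (\<lambda>a2 a3.
      mul L (act x1 a1) (act (mul H (p x2 a2) (r x3 a3)) b)))))"
    by (simp add: circ_eq cosum_act mul_act coassoc)
  also have "\<dots> = cosum ?s H x (\<lambda>x1 x2. cosum ?s L a (\<lambda>a1 a2. mul L (act x1 a1) (act (q x2 a2) b)))"
    using p_r[of ?s "\<lambda>u. mul L _ (act u b)"] by simp
  also have "\<dots> = act x (a \<circ>\<^sub>\<pi> b)"
    by (simp add: circ_eq act_cosum act_mul mul_act sw)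
  finally show ?thesis by simp
qed

end

section \<open>The two Doi-Hopf modules\<close>

text \<open>
  The formula for the action \<open>R\<close> below gives \<^const>\<open>ract_H\<close> for \<open>K = H\<close>, \<open>\<psi> = id\<close>, \<open>\<theta> = \<pi>\<close>, and
  \<^const>\<open>ract_L\<close> for \<open>K = L\<^sub>[\<^sub>\<pi>\<^sub>]\<close>, \<open>\<psi> = \<pi>\<close>, \<open>\<theta> = id\<close>.
\<close>

locale rota_baxter_target = rota_baxter H L act \<pi> + K: hopf_alg K + psi: hopf_hom K H \<psi>
    + theta: hopf_hom "L_pi H L act \<pi>" K \<theta>
  for H :: "('k::field, 'h::ab_group_add) hopf_data"
    and L :: "('k, 'l::ab_group_add) hopf_data"
    and act :: "'h \<Rightarrow> 'l \<Rightarrow> 'l"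
    and \<pi> :: "'l \<Rightarrow> 'h"
    and K :: "('k, 'm::ab_group_add) hopf_data"
    and \<psi> :: "'m \<Rightarrow> 'h"
    and \<theta> :: "'l \<Rightarrow> 'm" +
  assumes psi_theta: "\<psi> (\<theta> a) = \<pi> a"
begin

lemmas lin_homs = psi.lin_hom theta.lin_hom[unfolded P_simps]
lemmas hom_simps = psi_theta theta.hom_scale[unfolded P_simps]
  theta.hom_one[unfolded P_simps] psi.cosum_hom theta.cosum_hom[unfolded P_simps cosum_P]
  psi.hom_mul psi.hom_ant theta.hom_mul[unfolded P_simps]

definition R where
  "R k a = cosum (scl K) K k (\<lambda>k1 k2. cosum (scl K) L a (\<lambda>a1 a2.
     mul K (mul K (ant K (\<theta> (act (\<psi> k1) a1))) k2) (\<theta> a2)))"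

lemma lin_R [simp]:
  "lin s (scl K) g \<Longrightarrow> lin s (scl K) (\<lambda>x. R (g x) b)"
  "lin s (scl L) f \<Longrightarrow> lin s (scl K) (\<lambda>x. R y (f x))"
  unfolding R_def by (simp_all add: lin_vsD lin_homs)

lemma lin_R_apply:
  assumes "lin (scl K) s h"
  shows "h (R k a) = cosum s K k (\<lambda>k1 k2. cosum s L a (\<lambda>a1 a2.
     h (mul K (mul K (ant K (\<theta> (act (\<psi> k1) a1))) k2) (\<theta> a2))))"
  unfolding R_def by (simp add: lin_cosum[OF assms])

lemma cosum_r_act_flip:
  assumes F: "\<And>a. lin (scl L) s (\<lambda>b. F a b)" "\<And>b. lin (scl H) s (\<lambda>a. F a b)"
  shows "cosum s K k (\<lambda>k1 k2. cosum s L a (\<lambda>a1 a2. F (r (\<psi> k1) a1) (act (\<psi> k2) a2))) =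
    cosum s K k (\<lambda>k1 k2. cosum s L a (\<lambda>a1 a2. F (r (\<psi> k2) a2) (act (\<psi> k1) a1)))"
proof -
  have vs [simp]: "vector_space s" using F(1) by (rule lin_vsD)
  note [simp] = lin_comp[OF F(1)] lin_comp[OF F(2)]
  note [simp] = lin_homs
  show ?thesis using r_act_flip[OF F, of "\<psi> k" a] by (simp add: hom_simps)
qed

text \<open>A Hopf algebra map commutes with antipodes and products, so \<open>\<psi>\<close>
  carries the formula for \<open>R\<close> to the one for \<open>r\<close>. In the case K = L_[pi]
  this is the right linearity of pi.\<close>

lemma psi_R: "\<psi> (R k a) = r (\<psi> k) a"
  by (subst lin_R_apply[of "scl H"]) (simp_all add: r_def lin_homs hom_simps H.mul_assoc)

text \<open>For K = H this makes the action compatible with the coproduct; for K = L_[pi] it is the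
  Doi-Hopf condition. Since S_K reverses coproducts, the first two legs come out crossed, and the
  exchange rule uncrosses them.\<close>

lemma cosum_R:
  assumes F: "\<And>a. lin (scl K) s (\<lambda>b. F a b)" "\<And>b. lin (scl H) s (\<lambda>a. F a b)"
  shows "cosum s K (R k a) (\<lambda>u v. F (\<psi> u) v) =
    cosum s K k (\<lambda>k1 k2. cosum s L a (\<lambda>a1 a2. F (r (\<psi> k1) a1) (R k2 a2)))"
proof -
  have vs [simp]: "vector_space s" using F(1) by (rule lin_vsD)
  note [simp] = lin_comp[OF F(1)] lin_comp[OF F(2)]
  note [simp] = lin_homs
  note sw = cosum_swap[of s L _ K, OF vs]
  note coassoc = K.cosum_coassoc L.cosum_coassoc K.cosum_gather L.cosum_gather sw
  have "cosum s K (R k a) (\<lambda>u v. F (\<psi> u) v) =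
    cosum s K k (\<lambda>k1 y. cosum s K y (\<lambda>k2 y. cosum s K y (\<lambda>k3 k4. cosum s L a (\<lambda>a1 b.
      cosum s L b (\<lambda>a2 b. cosum s L b (\<lambda>a3 a4.
      F (mul H (mul H (ant H (p (\<psi> k2) a2)) (\<psi> k3)) (\<pi> a3))
        (mul K (mul K (ant K (\<theta> (act (\<psi> k1) a1))) k4) (\<theta> a4))))))))"
    by (subst lin_R_apply[of s])
      (simp_all add: K.cosum_mul K.cosum_ant_arg cosum_act hom_simps coassoc)
  also have "\<dots> = cosum s K k (\<lambda>y k4. cosum s L a (\<lambda>b a4. cosum s K y (\<lambda>k1 k2. cosum s L b (\<lambda>a1 a2.
      F (r (\<psi> k2) a2) (mul K (mul K (ant K (\<theta> (act (\<psi> k1) a1))) k4) (\<theta> a4))))))"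
    by (simp add: lin_r_apply[OF F(2)] hom_simps coassoc H.mul_assoc)
  also have "\<dots> = cosum s K k (\<lambda>y k4. cosum s L a (\<lambda>b a4. cosum s K y (\<lambda>k1 k2. cosum s L b (\<lambda>a1 a2.
      F (r (\<psi> k1) a1) (mul K (mul K (ant K (\<theta> (act (\<psi> k2) a2))) k4) (\<theta> a4))))))"
    by (subst cosum_r_act_flip[of s "\<lambda>u v. F u (mul K (mul K (ant K (\<theta> v)) _) (\<theta> _))"]) simp_all
  also have "\<dots> = cosum s K k (\<lambda>k1 k2. cosum s L a (\<lambda>a1 a2. F (r (\<psi> k1) a1) (R k2 a2)))"
    by (simp add: lin_R_apply[OF F(1)] coassoc)
  finally show ?thesis .
qed

lemma R_one: "R k (one L) = k"
  by (simp add: R_def cosum_one_L psi.cou_hom lin_homs hom_simps)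

text \<open>In R(R(k, a), b) the two antipode factors merge into one, because S_K reverses products
  and \<open>\<theta>\<close> is multiplicative. The argument is then brought into the form of the
  matched pair identity.\<close>

lemma R_circ: "R k (a \<circ>\<^sub>\<pi> b) = R (R k a) b"
proof -
  let ?s = "scl K"
  note [simp] = lin_homs
  note sw = cosum_swap[of ?s L _ K, OF K.vs]
  note coassoc = K.cosum_coassoc L.cosum_coassoc K.cosum_gather L.cosum_gather sw
  have "R (R k a) b = cosum ?s K k (\<lambda>k1 k2. cosum ?s L a (\<lambda>a1 a2. cosum ?s L b (\<lambda>b1 b2.
      mul K (mul K (ant K (\<theta> (act (r (\<psi> k1) a1) b1))) (R k2 a2)) (\<theta> b2))))"
    unfolding R_def[of "R k a"]
    by (subst cosum_R[of ?s "\<lambda>u v.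
      cosum ?s L b (\<lambda>b1 b2. mul K (mul K (ant K (\<theta> (act u b1))) v) (\<theta> b2))"])
      simp_all
  also have "\<dots> =
    cosum ?s K k (\<lambda>y k3. cosum ?s L a (\<lambda>c a3. cosum ?s K y (\<lambda>k1 k2. cosum ?s L c (\<lambda>a1 a2.
    cosum ?s L b (\<lambda>b1 b2.
      mul K (mul K (ant K (\<theta> (act (\<psi> k2) a2 \<circ>\<^sub>\<pi> act (r (\<psi> k1) a1) b1))) k3) (\<theta> (a3 \<circ>\<^sub>\<pi> b2)))))))"
    unfolding R_def[of _ "_ :: 'l"]
    by (simp add: hom_simps K.mul_cosum K.ant_mul K.mul_assoc coassoc)
  \<comment> \<open>After this exchange the first leg acts on a_1 and the second goes through
    \<open>r\<close>, as on the right of \<open>act_circ\<close>.\<close>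
  also have "\<dots> =
    cosum ?s K k (\<lambda>y k3. cosum ?s L a (\<lambda>c a3. cosum ?s K y (\<lambda>k1 k2. cosum ?s L c (\<lambda>a1 a2.
    cosum ?s L b (\<lambda>b1 b2.
      mul K (mul K (ant K (\<theta> (act (\<psi> k1) a1 \<circ>\<^sub>\<pi> act (r (\<psi> k2) a2) b1))) k3) (\<theta> (a3 \<circ>\<^sub>\<pi> b2)))))))"
    by (subst cosum_r_act_flip[of ?s "\<lambda>u v. cosum ?s L b (\<lambda>b1 b2.
      mul K (mul K (ant K (\<theta> (v \<circ>\<^sub>\<pi> act u b1))) _) (\<theta> (_ \<circ>\<^sub>\<pi> b2)))"]) simp_all
  also have "\<dots> =
    cosum ?s K k (\<lambda>y k3. cosum ?s L a (\<lambda>c a3. cosum ?s L b (\<lambda>b1 b2. cosum ?s K y (\<lambda>k1 k2.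
    cosum ?s L c (\<lambda>a1 a2.
      mul K (mul K (ant K (\<theta> (act (\<psi> k1) a1 \<circ>\<^sub>\<pi> act (r (\<psi> k2) a2) b1))) k3) (\<theta> (a3 \<circ>\<^sub>\<pi> b2)))))))"
    by (simp add: sw cosum_swap[of ?s L b L])
  also have "\<dots> = cosum ?s K k (\<lambda>y k3. cosum ?s L a (\<lambda>c a3. cosum ?s L b (\<lambda>b1 b2.
      mul K (mul K (ant K (\<theta> (act (\<psi> y) (c \<circ>\<^sub>\<pi> b1)))) k3) (\<theta> (a3 \<circ>\<^sub>\<pi> b2)))))"
  proof -
    have "mul K (mul K (ant K (\<theta> (act (\<psi> y) (c \<circ>\<^sub>\<pi> d)))) u) v =
      cosum ?s K y (\<lambda>k1 k2. cosum ?s L c (\<lambda>a1 a2.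
      mul K (mul K (ant K (\<theta> (act (\<psi> k1) a1 \<circ>\<^sub>\<pi> act (r (\<psi> k2) a2) d))) u) v))" for y c d u v
      unfolding act_circ
      by (simp add: hom_simps lin_cosum[of "scl L" ?s "\<lambda>z. mul K (mul K (ant K (\<theta> z)) u) v"])
    then show ?thesis by simp
  qed
  also have "\<dots> = R k (a \<circ>\<^sub>\<pi> b)"
    unfolding R_def by (simp add: cosum_circ)
  finally show ?thesis by simp
qed

end

section \<open>The actions on H and L as two instances, and the morphism pi between them\<close>

context rota_baxter
begin

sublocale id_H: hopf_hom H H "\<lambda>x. x"
  by (rule H.hopf_hom_id)

sublocale id_P: hopf_hom P P "\<lambda>x. x"
  by (rule P.hopf_hom_id)

sublocale KH: rota_baxter_target H L act \<pi> H "\<lambda>x. x" \<pi>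
  by unfold_locales (rule refl)

sublocale KP: rota_baxter_target H L act \<pi> P \<pi> "\<lambda>x. x"
  by unfold_locales (rule refl)

text \<open>Both descriptions are needed: \<open>KH.R\<close> carries the module laws, while
  \<open>r\<close> is the form in which the action on \<open>H\<close> enters the statements about
  \<open>L\<close>.\<close>

lemma ract_H_eq: "ract_H H L act \<pi> = KH.R" "ract_H H L act \<pi> = r"
  by (simp_all add: fun_eq_iff ract_H_def KH.R_def r_def cosum_def H.mul_assoc)

lemma ract_L_eq: "ract_L H L act \<pi> = KP.R"
  by (simp add: fun_eq_iff ract_L_def KP.R_def cosum_def P_simps)

lemma cou_r: "cou H (r x a) = cou H x * cou L a"
  by (subst lin_r_apply[OF H.lin_cou])
    (use cosum_pair_counit(1)[of "(*)" "\<lambda>x a. cou H x * cou L a"] in \<open>simp add: mult.assoc\<close>)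

lemma right_module_coalgebra_H: "right_module_coalgebra P H (ract_H H L act \<pi>)"
proof -
  have "cop H (r c b) = tens2 (scl H) (scl H)
        (sw (cop H c) (\<lambda>(c1, c2). sw (cop L b) (\<lambda>(b1, b2). pure (r c1 b1, r c2 b2))))" for c b
  proof (rule H.cop_eqI)
    fix B :: "'h \<Rightarrow> 'h \<Rightarrow> 'k" assume "bilin (scl H) (scl H) (*) B"
    then show "cosum (*) H (r c b) B = fextend (*) (\<lambda>(a, b). B a b)
      (sw (cop H c) (\<lambda>(c1, c2). sw (cop L b) (\<lambda>(b1, b2). pure (r c1 b1, r c2 b2))))"
      using KH.cosum_R[of "(*)" B c b]
      by (simp add: fextend_sw_cosum fextend_pure bilinD flip: ract_H_eq(1), simp add: ract_H_eq(2))
  qed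
  moreover have "right_module P (scl H) r"
    using KH.R_one KH.R_circ
    by (simp add: right_module_def bilin_def P_simps flip: ract_H_eq(1), simp add: ract_H_eq(2))
  ultimately show ?thesis
    using H.coalgebra by (simp add: right_module_coalgebra_def ract_H_eq(2) P_simps cou_r)
qed

lemma doi_hopf_datum_P: "doi_hopf_datum P P (cop P) H (ract_H H L act \<pi>)"
  using is_hopf_P right_module_coalgebra_H
  by (simp add: doi_hopf_datum_def left_comodule_algebra_def is_hopf_def is_coalgebra_def left_comodule_def)

lemma doi_hopf_module_H:
  "doi_hopf_module P P (cop P) H (ract_H H L act \<pi>) (scl H) (ract_H H L act \<pi>) (cop H)"
  using doi_hopf_datum_P right_module_coalgebra_H
  by (simp add: doi_hopf_module_def right_module_coalgebra_def is_coalgebra_def left_comodule_def)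

lemma sweedler_coact_L:
  assumes "bilin (scl H) (scl L) s F"
  shows "sweedler s (coact_L H L \<pi> a) (\<lambda>(h, b). F h b) = cosum s L a (\<lambda>a1 a2. F (\<pi> a1) a2)"
proof -
  have vs: "vector_space s" using bilinD(1)[OF assms] by (rule lin_vsD)
  show ?thesis
    by (simp add: coact_L_def sweedler_tens2[OF assms] fextend_sw_cosum[OF vs] fextend_pure[OF vs])
qed

lemma coact_L_eqI:
  assumes "\<And>B. bilin (scl H) (scl L) (*) B \<Longrightarrow>
    cosum (*) L a (\<lambda>a1 a2. B (\<pi> a1) a2) = fextend (*) (\<lambda>(h, b). B h b) g"
  shows "coact_L H L \<pi> a = tens2 (scl H) (scl L) g"
  unfolding coact_L_def using assms
  by (intro tens2_eqI) (simp_all add: fextend_sw_cosum fextend_pure)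

text \<open>The coaction is the coproduct of \<open>L\<close> with its first leg pushed along the
  coalgebra map \<open>\<pi>\<close>, so the axioms come from those of the coproduct.\<close>

lemma left_comodule_L: "left_comodule H (scl L) (coact_L H L \<pi>)"
proof -
  \<comment> \<open>Whichever representative is chosen, a bilinear form sees only the Sweedler
    sum.\<close>
  have rep: "fextend (*) (\<lambda>(h, b). B h b) (rep (coact_L H L \<pi> a)) =
    cosum (*) L a (\<lambda>a1 a2. B (\<pi> a1) a2)"
    if "bilin (scl H) (scl L) (*) B" for a and B :: "'h \<Rightarrow> 'l \<Rightarrow> 'k"
    using sweedler_coact_L[OF that] by (simp add: sweedler_def)
  have lin: "lin (scl L) (*) (\<lambda>a. cosum (*) L a (\<lambda>a1 a2. B (\<pi> a1) a2))"
    if "bilin (scl H) (scl L) (*) B" for B :: "'h \<Rightarrow> 'l \<Rightarrow> 'k"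
    using that by (simp add: bilinD lin_comp[OF bilinD(2)[OF that]])
  have "tensor_linear (scl L) (scl H) (scl L) (coact_L H L \<pi>)"
    unfolding tensor_linear_def
  proof (intro conjI allI)
    fix m n :: 'l and c :: 'k
    show "coact_L H L \<pi> m \<in> range (tens2 (scl H) (scl L))" by (simp add: coact_L_def)
    show "coact_L H L \<pi> (m + n) =
      tens2 (scl H) (scl L) (rep (coact_L H L \<pi> m) + rep (coact_L H L \<pi> n))"
      using lin by (intro coact_L_eqI)
        (auto simp: Vector_Spaces.linear_iff rep lin_addD[OF lin_fextend])
    show "coact_L H L \<pi> (scl L c m) = tens2 (scl H) (scl L) (fscale c (rep (coact_L H L \<pi> m)))"
      using lin by (intro coact_L_eqI) (auto simp: Vector_Spaces.linear_iff rep lin_scaleD[OF lin_fextend])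
  qed simp_all
  moreover have "tens3 (scl H) (scl H) (scl L)
            (sw (coact_L H L \<pi> m) (\<lambda>(c, m0). sw (cop H c) (\<lambda>(c1, c2). pure (c1, c2, m0)))) =
          tens3 (scl H) (scl H) (scl L)
            (sw (coact_L H L \<pi> m) (\<lambda>(c, m0). sw (coact_L H L \<pi> m0) (\<lambda>(c', m00).
              pure (c, c', m00))))" for m
  proof (rule tens3_eqI)
    fix B :: "'h \<Rightarrow> 'h \<Rightarrow> 'l \<Rightarrow> 'k" assume "trilin (scl H) (scl H) (scl L) (*) B"
    then have B: "lin (scl H) (*) (\<lambda>a. B a b c)" "lin (scl H) (*) (\<lambda>a. B b a c)"
      "lin (scl L) (*) (B a b)"
      for a b c by (auto simp: trilin_def)
    note [simp] = lin_comp[OF B(1)] lin_comp[OF B(2)] lin_comp[OF B(3)]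
    have bl: "bilin (scl H) (scl L) (*) (\<lambda>c m0. cosum (*) H c (\<lambda>c1 c2. B c1 c2 m0))"
      "bilin (scl H) (scl L) (*) (\<lambda>c m0. cosum (*) L m0 (\<lambda>a1 a2. B c (\<pi> a1) a2))"
      "bilin (scl H) (scl L) (*) (B c)" for c
      by (simp_all add: bilin_def)
    have "fextend (*) (\<lambda>(a, b, c). B a b c)
        (sw (coact_L H L \<pi> m) (\<lambda>(c, m0). sw (cop H c) (\<lambda>(c1, c2). pure (c1, c2, m0)))) =
      cosum (*) L m (\<lambda>a1 a2. cosum (*) H (\<pi> a1) (\<lambda>c1 c2. B c1 c2 a2))"
      using sweedler_coact_L[OF bl(1), of m] by (simp add: fextend_sw_pair fextend_pure cosum_def)
    also have "\<dots> = cosum (*) L m (\<lambda>a1 a2. cosum (*) L a2 (\<lambda>a3 a4. B (\<pi> a1) (\<pi> a3) a4))"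
      by (simp add: cosum_pi L.cosum_coassoc)
    also have "\<dots> =
      fextend (*) (\<lambda>(a, b, c). B a b c)
        (sw (coact_L H L \<pi> m) (\<lambda>(c, m0). sw (coact_L H L \<pi> m0) (\<lambda>(c', m00). pure (c, c', m00))))"
      using sweedler_coact_L[OF bl(2), of m]
      by (simp add: fextend_sw_pair fextend_pure sweedler_coact_L[OF bl(3)])
    finally show "fextend (*) (\<lambda>(a, b, c). B a b c)
        (sw (coact_L H L \<pi> m) (\<lambda>(c, m0). sw (cop H c) (\<lambda>(c1, c2). pure (c1, c2, m0)))) =
      fextend (*) (\<lambda>(a, b, c). B a b c)
        (sw (coact_L H L \<pi> m) (\<lambda>(c, m0). sw (coact_L H L \<pi> m0) (\<lambda>(c', m00). pure (c, c', m00))))" .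
  qed simp_all
  moreover have "sweedler (scl L) (coact_L H L \<pi> m) (\<lambda>(c, m0). scl L (cou H c) m0) = m" for m
    by (subst sweedler_coact_L) (simp_all add: bilin_def)
  ultimately show ?thesis by (simp add: left_comodule_def)
qed

lemma doi_hopf_module_L:
  "doi_hopf_module P P (cop P) H (ract_H H L act \<pi>) (scl L) (ract_L H L act \<pi>) (coact_L H L \<pi>)"
proof -
  note [simp] = KP.lin_R[unfolded P_simps]
  have "right_module P (scl L) (ract_L H L act \<pi>)"
    using KP.R_one KP.R_circ
    by (simp add: right_module_def bilin_def P_simps ract_L_eq)
  moreover have "coact_L H L \<pi> (KP.R m a) = tens2 (scl H) (scl L)
        (sw (coact_L H L \<pi> m) (\<lambda>(c, m0). sw (cop L a) (\<lambda>(b, a0).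
          pure (r c b, KP.R m0 a0))))" for m a
  proof (rule coact_L_eqI)
    fix B :: "'h \<Rightarrow> 'l \<Rightarrow> 'k" assume B: "bilin (scl H) (scl L) (*) B"
    note [simp] = bilinD[OF B] lin_comp[OF bilinD(1)[OF B]] lin_comp[OF bilinD(2)[OF B]]
    have bl: "bilin (scl H) (scl L) (*) (\<lambda>c m0. cosum (*) L a (\<lambda>b a0. B (r c b) (KP.R m0 a0)))"
      by (simp add: bilin_def)
    have "fextend (*) (\<lambda>(h, b). B h b)
        (sw (coact_L H L \<pi> m) (\<lambda>(c, m0). sw (cop L a) (\<lambda>(b, a0). pure (r c b, KP.R m0 a0)))) =
      cosum (*) L m (\<lambda>a1 a2. cosum (*) L a (\<lambda>b a0. B (r (\<pi> a1) b) (KP.R a2 a0)))"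
      using sweedler_coact_L[OF bl, of m] by (simp add: fextend_sw_pair fextend_pure cosum_def)
    then show "cosum (*) L (KP.R m a) (\<lambda>a1 a2. B (\<pi> a1) a2) = fextend (*) (\<lambda>(h, b). B h b)
        (sw (coact_L H L \<pi> m) (\<lambda>(c, m0). sw (cop L a) (\<lambda>(b, a0). pure (r c b, KP.R m0 a0))))"
      using KP.cosum_R[of "(*)" B m a] by (simp add: P_simps cosum_P)
  qed
  ultimately show ?thesis
    using doi_hopf_datum_P left_comodule_L
    by (simp add: doi_hopf_module_def ract_H_eq(2) ract_L_eq P_simps)
qed

text \<open>Linearity over L_[pi] is \<open>KP.psi_R\<close>; colinearity is compatibility of
  \<open>\<pi>\<close> with coproducts.\<close>

lemma doi_hopf_morphism_pi:
  "doi_hopf_morphism P P (cop P) H (ract_H H L act \<pi>) (scl L) (ract_L H L act \<pi>) (coact_L H L \<pi>)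
     (scl H) (ract_H H L act \<pi>) (cop H) \<pi>"
proof -
  have "cop H (\<pi> m) = tens2 (scl H) (scl H) (sw (coact_L H L \<pi> m) (\<lambda>(c, m0). pure (c, \<pi> m0)))" for m
  proof (rule H.cop_eqI)
    fix B :: "'h \<Rightarrow> 'h \<Rightarrow> 'k" assume B: "bilin (scl H) (scl H) (*) B"
    note [simp] = bilinD[OF B] lin_comp[OF bilinD(1)[OF B]] lin_comp[OF bilinD(2)[OF B]]
    have bl: "bilin (scl H) (scl L) (*) (\<lambda>c m0. B c (\<pi> m0))"
      by (simp add: bilin_def)
    show "cosum (*) H (\<pi> m) B =
      fextend (*) (\<lambda>(a, b). B a b) (sw (coact_L H L \<pi> m) (\<lambda>(c, m0). pure (c, \<pi> m0)))"
      using sweedler_coact_L[OF bl] by (simp add: fextend_sw_pair fextend_pure cosum_pi)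
  qed
  moreover have "lin (scl L) (scl H) \<pi>"
    by (rule lin_pi[OF lin_id]) simp
  ultimately show ?thesis
    using doi_hopf_module_L doi_hopf_module_H
    by (simp add: doi_hopf_morphism_def ract_H_eq(2) ract_L_eq KP.psi_R)
qed

end

theorem corollary5p7:
  fixes H :: "('k::field, 'h::ab_group_add) hopf_data"
    and L :: "('k, 'l::ab_group_add) hopf_data"
    and act :: "'h \<Rightarrow> 'l \<Rightarrow> 'l"
    and \<pi> :: "'l \<Rightarrow> 'h"
  assumes "is_hopf H"
    and "rel_rota_baxter H L act \<pi>"
  shows "doi_hopf_morphism
           (L_pi H L act \<pi>) (L_pi H L act \<pi>) (cop (L_pi H L act \<pi>)) H (ract_H H L act \<pi>)
           (scl L) (ract_L H L act \<pi>) (coact_L H L \<pi>)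
           (scl H) (ract_H H L act \<pi>) (cop H)
           \<pi>"
proof -
  interpret rota_baxter H L act \<pi>
    by unfold_locales fact+
  show ?thesis by (rule doi_hopf_morphism_pi)
qed

end
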